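(* Let $n\ge 2$ be an integer and let $g=e^{2u}|dx|^2$ be a smooth, complete, normal conformal metric on $\mathbb{R}^n$. (1) If $Q_g^{(n)}\ge 0$ everywhere on $\mathbb{R}^n$, then the sectional curvature of $g$ is non-negative (for every point $p$ and every $2$-plane in $T_p\mathbb{R}^n$). (2) If $Q_g^{(n)}\le 0$ everywhere on $\mathbb{R}^n$, then the sectional curvature of $g$ is non-positive (for every point $p$ and every $2$-plane in $T_p\mathbb{R}^n$).
   Context: For a smooth function $u$ on $\mathbb{R}^n$, $g=e^{2u}|dx|^2$ denotes the conformal metric, and its $n$-th order $Q$-curvature is $Q_g^{(n)}=e^{-nu}(-\Delta)^{n/2}u$. When $n$ is even this is a local differential operator. When $n$ is odd, $(-\Delta)^{n/2}=(-\Delta)^{1/2}\circ(-\Delta)^{(n-1)/2}$, where $(-\Delta)^{1/2}f(x)=C(n)\,\mathrm{P.V.}\int_{\mathbb{R}^n}\frac{f(x)-f(y)}{|x-y|^{n+1}}dy$ with the standard normalizing constant $C(n)$, and one assumes $\int_{\mathbb{R}^n}\frac{|(-\Delta)^{(n-1)/2}u(x)|}{1+|x|^{n+1}}dx<\infty$ so that $Q_g^{(n)}$ is well defined. $|\mathbb{S}^n|$ is the volume of the standard unit $n$-sphere. The metric $g$ has finite total $Q$-curvature if $Q_g^{(n)}e^{nu}\in L^1(\mathbb{R}^n)$. A metric with finite total $Q$-curvature is called normal if there is a constant $C$ such that for all $x\in\mathbb{R}^n$ $$u(x)=\frac{2}{(n-1)!|\mathbb{S}^n|}\int_{\mathbb{R}^n}\log\frac{|y|}{|x-y|}\,Q_g^{(n)}(y)e^{nu(y)}\,dy+C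 .$$ The sectional curvature of the plane spanned by $g$-orthonormal $E_1,E_2\in T_p\mathbb{R}^n$ is $g(R(E_1,E_2)E_2,E_1)$, with $R$ the Riemann curvature tensor of $g$. *)

theory Defs
  imports "HOL-Analysis.Analysis"
begin

subsection \<open>Smooth functions and the Laplacian\<close>

definition partial :: "'n \<Rightarrow> (real ^ 'n \<Rightarrow> real) \<Rightarrow> real ^ 'n::finite \<Rightarrow> real" where
  "partial i f x = frechet_derivative f (at x) (axis i 1)"

fun Ck :: "nat \<Rightarrow> (real ^ 'n::finite \<Rightarrow> real) \<Rightarrow> bool" where
  "Ck 0 f \<longleftrightarrow> continuous_on UNIV f"
| "Ck (Suc k) f \<longleftrightarrow> (\<forall>x. f differentiable at x) \<and> (\<forall>i. Ck k (partial i f))"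

definition smooth :: "(real ^ 'n::finite \<Rightarrow> real) \<Rightarrow> bool" where
  "smooth f \<longleftrightarrow> (\<forall>k. Ck k f)"

definition neg_laplacian :: "(real ^ 'n::finite \<Rightarrow> real) \<Rightarrow> real ^ 'n \<Rightarrow> real" where
  "neg_laplacian f x = - (\<Sum>i\<in>UNIV. partial i (partial i f) x)"

text \<open>
  The constant is \<open>C(n) = \<Gamma>((n+1)/2) / \<pi>\<^sup>(\<^sup>n\<^sup>+\<^sup>1\<^sup>)\<^sup>/\<^sup>2\<close>,
  for which the operator has Fourier symbol \<open>|\<xi>|\<close> (so that its square is \<open>-\<Delta>\<close>).
\<close>
definition half_laplacian :: "(real ^ 'n::finite \<Rightarrow> real) \<Rightarrow> real ^ 'n \<Rightarrow> real" where
  "half_laplacian f x =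
     Gamma ((real CARD('n) + 1) / 2) / pi powr ((real CARD('n) + 1) / 2) *
     Lim (at_right 0) (\<lambda>\<epsilon>. LINT y:{y. \<epsilon> \<le> dist x y}|lborel.
       (f x - f y) / norm (x - y) ^ (CARD('n) + 1))"

subsection \<open>Riemannian metrics on \<open>\<real>\<^sup>n\<close> in the standard coordinates\<close>

text \<open>A metric is given by its coefficient matrix \<open>G x $ i $ j = g\<^sub>i\<^sub>j(x)\<close>.\<close>

type_synonym 'n metric_field = "real ^ 'n \<Rightarrow> real ^ 'n ^ 'n"

definition metric_inner :: "'n::finite metric_field \<Rightarrow> real ^ 'n \<Rightarrow> real ^ 'n \<Rightarrow> real ^ 'n \<Rightarrow> real" where
  "metric_inner G p v w = (\<Sum>i\<in>UNIV. \<Sum>j\<in>UNIV. G p $ i $ j * v $ i * w $ j)"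

text \<open>
  The length is a non-negative Lebesgue integral with values in \<open>[0,\<infinity>]\<close>: the derivative of a
  piecewise \<open>C\<^sup>1\<close> path in the sense of \<^const>\<open>valid_path\<close> may be unbounded near a break point,
  and such a path can have infinite length.
\<close>
definition metric_length :: "'n::finite metric_field \<Rightarrow> (real \<Rightarrow> real ^ 'n) \<Rightarrow> ennreal" where
  "metric_length G \<gamma> = (\<integral>\<^sup>+t\<in>{0..1}.
     ennreal (sqrt (metric_inner G (\<gamma> t) (vector_derivative \<gamma> (at t)) (vector_derivative \<gamma> (at t))))
     \<partial>lborel)"

definition metric_dist :: "'n::finite metric_field \<Rightarrow> real ^ 'n \<Rightarrow> real ^ 'n \<Rightarrow> real" where
  "metric_dist G x y = enn2real
     (INF \<gamma>\<in>{\<gamma>. valid_path \<gamma> \<and> pathstart \<gamma> = x \<and> pathfinish \<gamma> = y}. metric_length G \<gamma>)"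

definition complete_metric :: "'n::finite metric_field \<Rightarrow> bool" where
  "complete_metric G \<longleftrightarrow>
     (\<forall>X :: nat \<Rightarrow> real ^ 'n.
        (\<forall>e>0. \<exists>N. \<forall>k\<ge>N. \<forall>m\<ge>N. metric_dist G (X k) (X m) < e) \<longrightarrow>
        (\<exists>l. (\<lambda>k. metric_dist G (X k) l) \<longlonglongrightarrow> 0))"

definition christoffel :: "'n::finite metric_field \<Rightarrow> 'n \<Rightarrow> 'n \<Rightarrow> 'n \<Rightarrow> real ^ 'n \<Rightarrow> real" where
  "christoffel G k i j x = (\<Sum>l\<in>UNIV. matrix_inv (G x) $ k $ l *
     (partial i (\<lambda>y. G y $ j $ l) x + partial j (\<lambda>y. G y $ i $ l) x - partial l (\<lambda>y. G y $ i $ j) x)) / 2"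

text \<open>
  \<open>riemann_coeff G l i j k\<close> is the \<open>l\<close>-th component of \<open>R(\<partial>\<^sub>i, \<partial>\<^sub>j) \<partial>\<^sub>k\<close>, with the convention
  \<open>R(X, Y) Z = \<nabla>\<^sub>X \<nabla>\<^sub>Y Z - \<nabla>\<^sub>Y \<nabla>\<^sub>X Z - \<nabla>\<^sub>[\<^sub>X\<^sub>,\<^sub>Y\<^sub>] Z\<close>; then \<open>g(R(E\<^sub>1, E\<^sub>2) E\<^sub>2, E\<^sub>1)\<close> is positive
  on round spheres.
\<close>
definition riemann_coeff ::
    "'n::finite metric_field \<Rightarrow> 'n \<Rightarrow> 'n \<Rightarrow> 'n \<Rightarrow> 'n \<Rightarrow> real ^ 'n \<Rightarrow> real" where
  "riemann_coeff G l i j k x =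
     partial i (christoffel G l j k) x - partial j (christoffel G l i k) x +
     (\<Sum>m\<in>UNIV. christoffel G l i m x * christoffel G m j k x
               - christoffel G l j m x * christoffel G m i k x)"

definition riemann ::
    "'n::finite metric_field \<Rightarrow> real ^ 'n \<Rightarrow> real ^ 'n \<Rightarrow> real ^ 'n \<Rightarrow> real ^ 'n \<Rightarrow> real ^ 'n" where
  "riemann G p X Y Z = (\<chi> l. \<Sum>i\<in>UNIV. \<Sum>j\<in>UNIV. \<Sum>k\<in>UNIV.
     riemann_coeff G l i j k p * X $ i * Y $ j * Z $ k)"

definition metric_orthonormal :: "'n::finite metric_field \<Rightarrow> real ^ 'n \<Rightarrow> real ^ 'n \<Rightarrow> real ^ 'n \<Rightarrow> bool" where
  "metric_orthonormal G p E1 E2 \<longleftrightarrow>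
     metric_inner G p E1 E1 = 1 \<and> metric_inner G p E2 E2 = 1 \<and> metric_inner G p E1 E2 = 0"

text \<open>The sectional curvature of the plane spanned by a \<open>g\<close>-orthonormal pair \<open>E1\<close>, \<open>E2\<close> at \<open>p\<close>.\<close>
definition sectional_curvature ::
    "'n::finite metric_field \<Rightarrow> real ^ 'n \<Rightarrow> real ^ 'n \<Rightarrow> real ^ 'n \<Rightarrow> real" where
  "sectional_curvature G p E1 E2 = metric_inner G p (riemann G p E1 E2 E2) E1"

subsection \<open>Conformal metrics and \<open>Q\<close>-curvature\<close>

definition conformal_metric :: "(real ^ 'n \<Rightarrow> real) \<Rightarrow> 'n::finite metric_field" where
  "conformal_metric u x = exp (2 * u x) *\<^sub>R mat 1"

text \<open>For odd \<open>n\<close>, \<open>n div 2\<close> is \<open>(n - 1) / 2\<close>.\<close>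
definition neg_laplacian_half_n :: "(real ^ 'n::finite \<Rightarrow> real) \<Rightarrow> real ^ 'n \<Rightarrow> real" where
  "neg_laplacian_half_n u =
     (if even CARD('n) then (neg_laplacian ^^ (CARD('n) div 2)) u
      else half_laplacian ((neg_laplacian ^^ (CARD('n) div 2)) u))"

text \<open>The standing integrability assumption under which the \<open>Q\<close>-curvature is defined.\<close>
definition Q_well_defined :: "(real ^ 'n::finite \<Rightarrow> real) \<Rightarrow> bool" where
  "Q_well_defined u \<longleftrightarrow> (odd CARD('n) \<longrightarrow>
     integrable lborel (\<lambda>x. \<bar>(neg_laplacian ^^ (CARD('n) div 2)) u x\<bar> / (1 + norm x ^ (CARD('n) + 1))))"

definition Q_curvature :: "(real ^ 'n::finite \<Rightarrow> real) \<Rightarrow> real ^ 'n \<Rightarrow> real" where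
  "Q_curvature u x = exp (- real CARD('n) * u x) * neg_laplacian_half_n u x"

definition finite_total_Q :: "(real ^ 'n::finite \<Rightarrow> real) \<Rightarrow> bool" where
  "finite_total_Q u \<longleftrightarrow> integrable lborel (\<lambda>x. Q_curvature u x * exp (real CARD('n) * u x))"

text \<open>The volume of the unit sphere in \<open>\<real>\<^sup>n\<^sup>+\<^sup>1\<close>: \<open>n + 1\<close> times the volume of the unit ball it bounds.\<close>
definition sphere_vol :: "nat \<Rightarrow> real" where
  "sphere_vol n = (real n + 1) * unit_ball_vol (real n + 1)"

definition normal_metric :: "(real ^ 'n::finite \<Rightarrow> real) \<Rightarrow> bool" where
  "normal_metric u \<longleftrightarrow> finite_total_Q u \<and>
     (\<exists>C. \<forall>x. u x = 2 / (fact (CARD('n) - 1) * sphere_vol CARD('n)) *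
        (LINT y|lborel. ln (norm y / norm (x - y)) * Q_curvature u y * exp (real CARD('n) * u y)) + C)"

end

theory Submission
  imports Defs
begin

text \<open>
  Write \<open>h\<close> for the multiple of \<open>Q e\<^sup>n\<^sup>u\<close> for which \<open>u(x) = \<integral> log (|y| / |x - y|) h(y) dy + C\<close>, and
  let \<open>a\<close>, \<open>b\<close> be a Euclidean orthonormal basis of the plane. The sectional curvature is
  \<open>- e\<^sup>-\<^sup>2\<^sup>u (u\<^sub>a\<^sub>a + u\<^sub>b\<^sub>b + |\<nabla>'u|\<^sup>2)\<close>, where \<open>\<nabla>'u\<close> is the component of the gradient orthogonal to
  the plane. Differentiating the potential, with \<open>z = x - y\<close> and \<open>z'\<close> its component orthogonal to
  the plane, \<open>u\<^sub>a\<^sub>a + u\<^sub>b\<^sub>b = - 2 \<integral> |z'|\<^sup>2 / |z|\<^sup>4 h\<close> and \<open>\<nabla>'u = - \<integral> z' / |z|\<^sup>2 h\<close>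
  if \<open>n \<ge> 3\<close>, while for \<open>n = 2\<close> the sum is a negative multiple of \<open>h\<close> and \<open>\<nabla>'u = 0\<close>. For \<open>h \<le> 0\<close> the sign is
  immediate; for \<open>h \<ge> 0\<close> Cauchy--Schwarz gives it as soon as \<open>\<integral> h \<le> 2\<close>. Completeness forces
  this, since otherwise \<open>e\<^sup>u\<close> decays like \<open>|x|\<^sup>-\<^sup>2\<close> or faster on average and some ray has finite
  length.

  No regularity of \<open>h\<close> beyond integrability enters. The kernel is regularised to
  \<open>log (|z|\<^sup>2 + \<epsilon>) / 2\<close>, where differentiation under the integral is harmless and the same
  inequality holds, and the limit \<open>\<epsilon> \<rightarrow> 0\<close> is taken in the viscosity sense.
\<close>

subsection \<open>Conformal metrics\<close>

definition grad :: "(real ^ 'n::finite \<Rightarrow> real) \<Rightarrow> real ^ 'n \<Rightarrow> real ^ 'n" where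
  "grad f x = (\<chi> i. partial i f x)"

definition hess :: "(real ^ 'n::finite \<Rightarrow> real) \<Rightarrow> real ^ 'n \<Rightarrow> real ^ 'n \<Rightarrow> real" where
  "hess f x a = (\<Sum>i\<in>UNIV. \<Sum>j\<in>UNIV. partial i (partial j f) x * a $ i * a $ j)"

lemma smooth_partial: "smooth f \<Longrightarrow> smooth (partial i f)"
  unfolding smooth_def by (metis Ck.simps(2))

lemma smooth_differentiable: "smooth f \<Longrightarrow> f differentiable at x"
  unfolding smooth_def by (metis Ck.simps(2))

lemma smooth_continuous: "smooth f \<Longrightarrow> continuous_on A f"
  unfolding smooth_def by (metis Ck.simps(1) continuous_on_subset top_greatest)

lemma partial_eqI:
  assumes "(f has_derivative D) (at x)"
  shows "partial i f x = D (axis i 1)"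
  using frechet_derivative_at[OF assms] unfolding partial_def by simp

lemma smooth_has_derivative:
  assumes "smooth f"
  shows "(f has_derivative (\<lambda>v. grad f x \<bullet> v)) (at x)"
proof -
  let ?D = "frechet_derivative f (at x)"
  have D: "(f has_derivative ?D) (at x)"
    using smooth_differentiable[OF assms] by (simp add: frechet_derivative_works)
  interpret linear ?D using D by (rule has_derivative_linear)
  have "?D v = grad f x \<bullet> v" for v
  proof -
    have "?D v = ?D (\<Sum>i\<in>UNIV. (v $ i) *s axis i 1)"
      by (simp add: basis_expansion)
    also have "\<dots> = (\<Sum>i\<in>UNIV. v $ i * ?D (axis i 1))"
      by (simp add: sum scale scalar_mult_eq_scaleR)
    also have "\<dots> = grad f x \<bullet> v"
      by (simp add: grad_def inner_vec_def partial_def mult.commute)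
    finally show ?thesis .
  qed
  then have "?D = (\<lambda>v. grad f x \<bullet> v)" by auto
  with D show ?thesis by simp
qed

lemma smooth_line_deriv:
  assumes "smooth f"
  shows "((\<lambda>s. f (x + s *\<^sub>R a)) has_real_derivative grad f (x + s *\<^sub>R a) \<bullet> a) (at s)"
proof -
  have "((\<lambda>s. f (x + s *\<^sub>R a)) has_derivative (\<lambda>t. grad f (x + s *\<^sub>R a) \<bullet> (t *\<^sub>R a))) (at s)"
    by (rule has_derivative_compose[where g = f, OF _ smooth_has_derivative[OF assms]])
      (auto intro!: derivative_eq_intros)
  also have "(\<lambda>t. grad f (x + s *\<^sub>R a) \<bullet> (t *\<^sub>R a)) = (*) (grad f (x + s *\<^sub>R a) \<bullet> a)"
    by (auto simp: mult.commute)
  finally show ?thesis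
    by (simp add: has_field_derivative_def)
qed

lemma smooth_line_deriv2:
  assumes "smooth f"
  shows "((\<lambda>s. grad f (x + s *\<^sub>R a) \<bullet> a) has_real_derivative hess f (x + s *\<^sub>R a) a) (at s)"
proof -
  have "((\<lambda>s. \<Sum>j\<in>UNIV. partial j f (x + s *\<^sub>R a) * a $ j) has_real_derivative
      (\<Sum>j\<in>UNIV. (grad (partial j f) (x + s *\<^sub>R a) \<bullet> a) * a $ j)) (at s)"
    by (intro DERIV_sum DERIV_cmult_right smooth_line_deriv smooth_partial assms)
  moreover have "(\<Sum>j\<in>UNIV. (grad (partial j f) y \<bullet> a) * a $ j) = hess f y a" for y
    unfolding hess_def grad_def inner_vec_def
    by (subst sum.swap) (simp add: sum_distrib_left sum_distrib_right mult_ac)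
  moreover have "grad f y \<bullet> a = (\<Sum>j\<in>UNIV. partial j f y * a $ j)" for y
    by (simp add: grad_def inner_vec_def)
  ultimately show ?thesis by simp
qed

lemma continuous_on_grad: "smooth f \<Longrightarrow> continuous_on A (\<lambda>x. grad f x \<bullet> a)"
  unfolding grad_def inner_vec_def inner_real_def vec_lambda_beta
  by (intro continuous_on_sum continuous_on_mult_right) (auto intro: smooth_continuous smooth_partial)

lemma continuous_on_hess: "smooth f \<Longrightarrow> continuous_on A (\<lambda>x. hess f x a)"
  unfolding hess_def
  by (intro continuous_on_sum continuous_on_mult_right) (auto intro: smooth_continuous smooth_partial)

section \<open>Connection and curvature of a conformal metric\<close>

lemma conformal_metric_nth:
  "conformal_metric u x $ i $ j = (if i = j then exp (2 * u x) else 0)"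
  by (simp add: conformal_metric_def mat_def)

lemma metric_inner_conformal:
  "metric_inner (conformal_metric u) p v w = exp (2 * u p) * (v \<bullet> w)"
proof -
  have "metric_inner (conformal_metric u) p v w
      = (\<Sum>i\<in>UNIV. \<Sum>j\<in>UNIV. if i = j then exp (2 * u p) * v $ i * w $ j else 0)"
    unfolding metric_inner_def conformal_metric_nth by (intro sum.cong) auto
  then show ?thesis
    by (simp add: inner_vec_def sum_distrib_left mult_ac)
qed

lemma matrix_inv_conformal:
  "matrix_inv (conformal_metric u x) = exp (- 2 * u x) *\<^sub>R mat 1"
proof -
  let ?A = "conformal_metric u x" and ?B = "exp (- 2 * u x) *\<^sub>R mat 1 :: real ^ 'a ^ 'a"
  have AB: "?A ** ?B = mat 1" and BA: "?B ** ?A = mat 1"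
    by (simp_all add: conformal_metric_def flip: matrix_scalar_ac scalar_matrix_assoc exp_add)
  \<comment> \<open>\<open>matrix_inv\<close> is a Hilbert choice. The explicit inverse
    \<open>?B\<close> witnesses that a two-sided inverse exists, so the chosen matrix is one, and
    associativity identifies it with \<open>?B\<close>.\<close>
  have "?A ** matrix_inv ?A = mat 1 \<and> matrix_inv ?A ** ?A = mat 1"
    unfolding matrix_inv_def by (rule someI[where x = ?B]) (rule conjI[OF AB BA])
  then have "matrix_inv ?A ** (?A ** ?B) = ?B"
    by (simp add: matrix_mul_assoc)
  with AB show ?thesis by simp
qed

lemma partial_conformal:
  assumes "smooth u"
  shows "partial l (\<lambda>y. conformal_metric u y $ i $ j) x
    = (if i = j then 2 * exp (2 * u x) * partial l u x else 0)"
proof (cases "i = j")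
  case True
  have "((\<lambda>y. exp (2 * u y)) has_derivative
      (\<lambda>v. exp (2 * u x) * (2 * (grad u x \<bullet> v)))) (at x)"
    by (auto intro!: derivative_eq_intros smooth_has_derivative[OF assms])
  from partial_eqI[OF this] True show ?thesis
    by (simp add: conformal_metric_nth grad_def inner_axis)
next
  case False
  then show ?thesis
    using partial_eqI[of "\<lambda>y. 0" "\<lambda>v. 0"] by (simp add: conformal_metric_nth)
qed

text \<open>For \<open>v\<close> the gradient of \<open>u\<close> this is the Christoffel symbol of
  \<open>e^(2u) |dx|^2\<close>. Keeping \<open>v\<close> as an argument exploits linearity: the
  derivative of the symbol has the same form, with \<open>v\<close> replaced by a row of the
  Hessian.\<close>

definition conformal_connection :: "real ^ 'n::finite \<Rightarrow> 'n \<Rightarrow> 'n \<Rightarrow> 'n \<Rightarrow> real" where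
  "conformal_connection v k i j =
    of_bool (j = k) * v $ i + of_bool (i = k) * v $ j - of_bool (i = j) * v $ k"

lemma christoffel_conformal:
  assumes "smooth u"
  shows "christoffel (conformal_metric u) k i j x = conformal_connection (grad u x) k i j"
proof -
  let ?T = "\<lambda>l. partial i (\<lambda>y. conformal_metric u y $ j $ l) x
     + partial j (\<lambda>y. conformal_metric u y $ i $ l) x
     - partial l (\<lambda>y. conformal_metric u y $ i $ j) x"
  have "christoffel (conformal_metric u) k i j x
      = (\<Sum>l\<in>UNIV. if l = k then exp (- 2 * u x) * ?T k else 0) / 2"
    unfolding christoffel_def matrix_inv_conformal
    by (intro arg_cong2[where f = "(/)"] sum.cong) (auto simp: mat_def)
  also have "\<dots> = exp (- 2 * u x) * ?T k / 2" by simp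
  also have "?T k = 2 * exp (2 * u x) * conformal_connection (grad u x) k i j"
    by (auto simp: partial_conformal[OF assms] conformal_connection_def grad_def algebra_simps)
  finally show ?thesis
    by (simp add: exp_minus field_simps)
qed

lemma partial_christoffel_conformal:
  assumes "smooth u"
  shows "partial m (christoffel (conformal_metric u) k i j) x =
    conformal_connection (\<chi> i. partial m (partial i u) x) k i j"
proof -
  note D = smooth_has_derivative[OF smooth_partial[OF assms]]
  have "(christoffel (conformal_metric u) k i j has_derivative
    (\<lambda>v. of_bool (j = k) * (grad (partial i u) x \<bullet> v)
    + of_bool (i = k) * (grad (partial j u) x \<bullet> v)
    - of_bool (i = j) * (grad (partial k u) x \<bullet> v))) (at x)"
    unfolding christoffel_conformal[OF assms, abs_def] conformal_connection_def grad_def[of u] vec_lambda_beta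
    by (intro has_derivative_add has_derivative_diff has_derivative_mult_right D)
  from partial_eqI[OF this] show ?thesis
    by (simp add: grad_def inner_axis conformal_connection_def)
qed

text \<open>Each Kronecker delta collapses one of the two sums. With this the curvature can be
  computed by inner products instead of indices.\<close>

lemma conformal_connection_contract:
  "(\<Sum>i\<in>UNIV. \<Sum>j\<in>UNIV. conformal_connection v k i j * a $ i * b $ j)
    = (v \<bullet> a) * b $ k + (v \<bullet> b) * a $ k - (a \<bullet> b) * v $ k"
proof -
  have delta: "(\<Sum>i\<in>UNIV. of_bool (i = k) * f i) = f k"
      "(\<Sum>i\<in>UNIV. of_bool (k = i) * f i) = f k" for f :: "'a \<Rightarrow> real" and k
    by (simp_all add: of_bool_def if_distrib[of "\<lambda>c. c * _"] cong: if_cong)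
  have 1: "(\<Sum>j\<in>UNIV. conformal_connection v k i j * a $ i * b $ j)
    = v $ i * a $ i * b $ k + of_bool (i = k) * (a $ i * (v \<bullet> b)) - v $ k * (a $ i * b $ i)" for i
  proof -
    have "(\<Sum>j\<in>UNIV. conformal_connection v k i j * a $ i * b $ j)
      = (\<Sum>j\<in>UNIV. of_bool (j = k) * (v $ i * a $ i * b $ j))
      + of_bool (i = k) * (a $ i * (\<Sum>j\<in>UNIV. v $ j * b $ j))
      - (\<Sum>j\<in>UNIV. of_bool (i = j) * (v $ k * (a $ i * b $ j)))"
      unfolding conformal_connection_def sum_distrib_left sum.distrib[symmetric] sum_subtractf[symmetric]
      by (intro sum.cong refl) (simp add: algebra_simps)
    then show ?thesis unfolding delta by (simp add: inner_vec_def)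
  qed
  show ?thesis
    unfolding 1 sum.distrib sum_subtractf delta
    by (simp add: inner_vec_def sum_distrib_left sum_distrib_right mult_ac)
qed

text \<open>Reordering the sums contracts the inner connection to a vector first, so the quadratic
  terms of the curvature become two successive applications of the previous contraction.\<close>

lemma connection_product_contract:
  fixes A :: "'n::finite \<Rightarrow> 'n \<Rightarrow> real" and B :: "'n \<Rightarrow> 'n \<Rightarrow> 'n \<Rightarrow> real"
  shows "(\<Sum>i\<in>UNIV. \<Sum>j\<in>UNIV. \<Sum>k\<in>UNIV. (\<Sum>m\<in>UNIV. A i m * B m j k) * X i * Y j * Z k)
    = (\<Sum>i\<in>UNIV. \<Sum>m\<in>UNIV. A i m * X i * (\<Sum>j\<in>UNIV. \<Sum>k\<in>UNIV. B m j k * Y j * Z k))"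
proof (rule sum.cong[OF refl])
  fix i
  have "(\<Sum>j\<in>UNIV. \<Sum>k\<in>UNIV. (\<Sum>m\<in>UNIV. A i m * B m j k) * X i * Y j * Z k)
    = (\<Sum>j\<in>UNIV. \<Sum>k\<in>UNIV. \<Sum>m\<in>UNIV. A i m * X i * (B m j k * Y j * Z k))"
    by (simp add: sum_distrib_left sum_distrib_right mult_ac)
  also have "\<dots> = (\<Sum>j\<in>UNIV. \<Sum>m\<in>UNIV. \<Sum>k\<in>UNIV. A i m * X i * (B m j k * Y j * Z k))"
    by (rule sum.cong[OF refl]) (rule sum.swap)
  also have "\<dots> = (\<Sum>m\<in>UNIV. \<Sum>j\<in>UNIV. \<Sum>k\<in>UNIV. A i m * X i * (B m j k * Y j * Z k))"
    by (rule sum.swap)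
  finally show "(\<Sum>j\<in>UNIV. \<Sum>k\<in>UNIV. (\<Sum>m\<in>UNIV. A i m * B m j k) * X i * Y j * Z k)
    = (\<Sum>m\<in>UNIV. A i m * X i * (\<Sum>j\<in>UNIV. \<Sum>k\<in>UNIV. B m j k * Y j * Z k))"
    by (simp add: sum_distrib_left)
qed

lemma riemann_conformal_nth:
  fixes p X Y :: "real ^ 'n::finite"
  assumes "smooth u" and XY: "X \<bullet> Y = 0"
  defines "g \<equiv> grad u p"
  defines "H \<equiv> \<lambda>i. \<chi> j. partial i (partial j u) p"
  shows "riemann (conformal_metric u) p X Y Y $ l =
    (\<Sum>i\<in>UNIV. X $ i * (2 * (H i \<bullet> Y) * Y $ l - (Y \<bullet> Y) * H i $ l))
    - (\<Sum>j\<in>UNIV. Y $ j * ((H j \<bullet> X) * Y $ l + (H j \<bullet> Y) * X $ l))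
    + ((g \<bullet> X) * (2 * (g \<bullet> Y) * Y $ l - (Y \<bullet> Y) * g $ l)
       + (2 * (g \<bullet> Y) ^ 2 - (Y \<bullet> Y) * (g \<bullet> g)) * X $ l + (Y \<bullet> Y) * (g \<bullet> X) * g $ l)
    - ((g \<bullet> Y) * ((g \<bullet> X) * Y $ l + (g \<bullet> Y) * X $ l) + 2 * (g \<bullet> X) * (g \<bullet> Y) * Y $ l
       - (Y \<bullet> Y) * (g \<bullet> X) * g $ l)"
proof -
  let ?C = "conformal_connection"
  let ?V = "\<chi> m. \<Sum>j\<in>UNIV. \<Sum>k\<in>UNIV. ?C g m j k * Y $ j * Y $ k"
  let ?W = "\<chi> m. \<Sum>i\<in>UNIV. \<Sum>k\<in>UNIV. ?C g m i k * X $ i * Y $ k"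
  \<comment> \<open>\<open>?V\<close> and \<open>?W\<close> are the inner connection terms for the
    pairs \<open>(Y, Y)\<close> and \<open>(X, Y)\<close>. In \<open>?W\<close> the term along
    \<open>g\<close> drops out because \<open>X\<close> and \<open>Y\<close> are orthogonal.\<close>
  have V: "?V = (2 * (g \<bullet> Y)) *\<^sub>R Y - (Y \<bullet> Y) *\<^sub>R g"
    by (simp add: vec_eq_iff conformal_connection_contract)
  have W: "?W = (g \<bullet> X) *\<^sub>R Y + (g \<bullet> Y) *\<^sub>R X"
    by (simp add: vec_eq_iff conformal_connection_contract XY)
  have "riemann (conformal_metric u) p X Y Y $ l =
     (\<Sum>i\<in>UNIV. \<Sum>j\<in>UNIV. \<Sum>k\<in>UNIV. (?C (H i) l j k - ?C (H j) l i k
       + (\<Sum>m\<in>UNIV. ?C g l i m * ?C g m j k) - (\<Sum>m\<in>UNIV. ?C g l j m * ?C g m i k))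
       * X $ i * Y $ j * Y $ k)"
    by (simp add: riemann_def riemann_coeff_def christoffel_conformal[OF assms(1)]
      partial_christoffel_conformal[OF assms(1)] g_def H_def sum_subtractf algebra_simps)
  also have "\<dots> = (\<Sum>i\<in>UNIV. \<Sum>j\<in>UNIV. \<Sum>k\<in>UNIV. ?C (H i) l j k * X $ i * Y $ j * Y $ k)
     - (\<Sum>i\<in>UNIV. \<Sum>j\<in>UNIV. \<Sum>k\<in>UNIV. ?C (H j) l i k * X $ i * Y $ j * Y $ k)
     + (\<Sum>i\<in>UNIV. \<Sum>j\<in>UNIV. \<Sum>k\<in>UNIV. (\<Sum>m\<in>UNIV. ?C g l i m * ?C g m j k) * X $ i * Y $ j * Y $ k)
     - (\<Sum>i\<in>UNIV. \<Sum>j\<in>UNIV. \<Sum>k\<in>UNIV. (\<Sum>m\<in>UNIV. ?C g l j m * ?C g m i k) * X $ i * Y $ j * Y $ k)"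
    by (simp only: left_diff_distrib distrib_right sum.distrib sum_subtractf)
  also have "(\<Sum>i\<in>UNIV. \<Sum>j\<in>UNIV. \<Sum>k\<in>UNIV. ?C (H i) l j k * X $ i * Y $ j * Y $ k)
    = (\<Sum>i\<in>UNIV. X $ i * (\<Sum>j\<in>UNIV. \<Sum>k\<in>UNIV. ?C (H i) l j k * Y $ j * Y $ k))"
    by (simp add: sum_distrib_left mult_ac)
  also have "\<dots> = (\<Sum>i\<in>UNIV. X $ i * (2 * (H i \<bullet> Y) * Y $ l - (Y \<bullet> Y) * H i $ l))"
    unfolding conformal_connection_contract by (simp add: mult_ac)
  also have "(\<Sum>i\<in>UNIV. \<Sum>j\<in>UNIV. \<Sum>k\<in>UNIV. ?C (H j) l i k * X $ i * Y $ j * Y $ k)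
    = (\<Sum>j\<in>UNIV. Y $ j * (\<Sum>i\<in>UNIV. \<Sum>k\<in>UNIV. ?C (H j) l i k * X $ i * Y $ k))"
    by (subst sum.swap) (simp add: sum_distrib_left mult_ac)
  also have "\<dots> = (\<Sum>j\<in>UNIV. Y $ j * ((H j \<bullet> X) * Y $ l + (H j \<bullet> Y) * X $ l))"
    by (simp add: conformal_connection_contract XY)
  also have "(\<Sum>i\<in>UNIV. \<Sum>j\<in>UNIV. \<Sum>k\<in>UNIV. (\<Sum>m\<in>UNIV. ?C g l i m * ?C g m j k) * X $ i * Y $ j * Y $ k)
    = (\<Sum>i\<in>UNIV. \<Sum>m\<in>UNIV. ?C g l i m * X $ i * ?V $ m)"
    by (simp add: connection_product_contract)
  also have "\<dots> = (g \<bullet> X) * (2 * (g \<bullet> Y) * Y $ l - (Y \<bullet> Y) * g $ l)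
       + (2 * (g \<bullet> Y) ^ 2 - (Y \<bullet> Y) * (g \<bullet> g)) * X $ l + (Y \<bullet> Y) * (g \<bullet> X) * g $ l"
  proof -
    have "(\<Sum>i\<in>UNIV. \<Sum>m\<in>UNIV. ?C g l i m * X $ i * ?V $ m)
      = (g \<bullet> X) * ?V $ l + (g \<bullet> ?V) * X $ l - (X \<bullet> ?V) * g $ l"
      by (rule conformal_connection_contract)
    then show ?thesis
      unfolding V by (simp add: inner_diff_right inner_commute XY power2_eq_square algebra_simps)
  qed
  also have "(\<Sum>i\<in>UNIV. \<Sum>j\<in>UNIV. \<Sum>k\<in>UNIV. (\<Sum>m\<in>UNIV. ?C g l j m * ?C g m i k) * X $ i * Y $ j * Y $ k)
    = (\<Sum>j\<in>UNIV. \<Sum>m\<in>UNIV. ?C g l j m * Y $ j * ?W $ m)"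
  proof -
    have "(\<Sum>i\<in>UNIV. \<Sum>j\<in>UNIV. \<Sum>k\<in>UNIV. (\<Sum>m\<in>UNIV. ?C g l j m * ?C g m i k) * X $ i * Y $ j * Y $ k)
      = (\<Sum>j\<in>UNIV. \<Sum>i\<in>UNIV. \<Sum>k\<in>UNIV. (\<Sum>m\<in>UNIV. ?C g l j m * ?C g m i k) * Y $ j * X $ i * Y $ k)"
      by (subst sum.swap) (simp add: mult_ac)
    then show ?thesis by (simp add: connection_product_contract)
  qed
  also have "\<dots> = (g \<bullet> Y) * ((g \<bullet> X) * Y $ l + (g \<bullet> Y) * X $ l) + 2 * (g \<bullet> X) * (g \<bullet> Y) * Y $ l
       - (Y \<bullet> Y) * (g \<bullet> X) * g $ l"
  proof -
    have "(\<Sum>j\<in>UNIV. \<Sum>m\<in>UNIV. ?C g l j m * Y $ j * ?W $ m)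
      = (g \<bullet> Y) * ?W $ l + (g \<bullet> ?W) * Y $ l - (Y \<bullet> ?W) * g $ l"
      by (rule conformal_connection_contract)
    then show ?thesis
      unfolding W by (simp add: inner_add_right inner_commute XY algebra_simps)
  qed
  finally show ?thesis .
qed

text \<open>Pairing the curvature vector with \<open>X\<close> kills every term along
  \<open>Y\<close>, among them both mixed Hessian terms, so only the diagonal values of the Hessian
  survive.\<close>

lemma sectional_curvature_conformal:
  assumes "smooth u" and XY: "X \<bullet> Y = 0"
  shows "sectional_curvature (conformal_metric u) p X Y = exp (2 * u p) *
    (- (Y \<bullet> Y) * hess u p X - (X \<bullet> X) * hess u p Y
      + (X \<bullet> X) * (grad u p \<bullet> Y)\<^sup>2 + (Y \<bullet> Y) * (grad u p \<bullet> X)\<^sup>2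
      - (X \<bullet> X) * (Y \<bullet> Y) * (grad u p \<bullet> grad u p))"
proof -
  let ?g = "grad u p" and ?H = "\<lambda>i. \<chi> j. partial i (partial j u) p"
  have hess: "hess u p a = (\<Sum>i\<in>UNIV. a $ i * (?H i \<bullet> a))" for a
    by (simp add: hess_def inner_vec_def sum_distrib_left mult_ac)
  let ?R = "riemann (conformal_metric u) p X Y Y"
  have eq: "?R = (2 * (\<Sum>i\<in>UNIV. X $ i * (?H i \<bullet> Y))) *\<^sub>R Y
    - (Y \<bullet> Y) *\<^sub>R (\<Sum>i\<in>UNIV. X $ i *\<^sub>R ?H i)
    - (\<Sum>j\<in>UNIV. Y $ j * (?H j \<bullet> X)) *\<^sub>R Y - (\<Sum>j\<in>UNIV. Y $ j * (?H j \<bullet> Y)) *\<^sub>R X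
    + ((?g \<bullet> X) *\<^sub>R (2 * (?g \<bullet> Y)) *\<^sub>R Y - ((?g \<bullet> X) * (Y \<bullet> Y)) *\<^sub>R ?g
       + (2 * (?g \<bullet> Y) ^ 2 - (Y \<bullet> Y) * (?g \<bullet> ?g)) *\<^sub>R X + ((Y \<bullet> Y) * (?g \<bullet> X)) *\<^sub>R ?g)
    - (((?g \<bullet> Y) * (?g \<bullet> X)) *\<^sub>R Y + ((?g \<bullet> Y) ^ 2) *\<^sub>R X + (2 * (?g \<bullet> X) * (?g \<bullet> Y)) *\<^sub>R Y
       - ((Y \<bullet> Y) * (?g \<bullet> X)) *\<^sub>R ?g)"
    by (simp add: vec_eq_iff riemann_conformal_nth[OF assms] sum_component sum_distrib_left
      sum_distrib_right sum.distrib sum_subtractf algebra_simps power2_eq_square)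
  have "(\<Sum>i\<in>UNIV. X $ i *\<^sub>R ?H i) \<bullet> X = hess u p X"
    by (simp add: hess inner_sum_left)
  then have "?R \<bullet> X = - (Y \<bullet> Y) * hess u p X - (X \<bullet> X) * hess u p Y
      + (X \<bullet> X) * (?g \<bullet> Y)\<^sup>2 + (Y \<bullet> Y) * (?g \<bullet> X)\<^sup>2 - (X \<bullet> X) * (Y \<bullet> Y) * (?g \<bullet> ?g)"
    unfolding eq hess[of Y]
    by (simp add: inner_add_left inner_diff_left XY inner_commute[of Y X] power2_eq_square algebra_simps)
  then show ?thesis
    by (simp add: sectional_curvature_def metric_inner_conformal)
qed

subsection \<open>Passing to the limit in second-order inequalities\<close>

text \<open>The sets where the gap is at least \<open>e\<close> are compact and decrease with
  \<open>k\<close>. If none were empty, a common point would contradict pointwise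
  convergence.\<close>

lemma Dini_compact:
  fixes V :: "nat \<Rightarrow> 'a::heine_borel \<Rightarrow> real"
  assumes S: "compact S" and V: "\<And>k. continuous_on S (V k)" and f: "continuous_on S f"
    and mono: "\<And>x. x \<in> S \<Longrightarrow> incseq (\<lambda>k. V k x)"
    and lim: "\<And>x. x \<in> S \<Longrightarrow> (\<lambda>k. V k x) \<longlonglongrightarrow> f x"
    and e: "e > 0"
  shows "\<exists>k. \<forall>x\<in>S. f x - V k x < e"
proof (rule ccontr)
  assume "\<not> ?thesis"
  then have ne: "{x\<in>S. e \<le> f x - V k x} \<noteq> {}" for k
    by (force simp: not_less)
  have "compact {x\<in>S. e \<le> f x - V k x}" for k
  proof -
    have "closedin (top_of_set S) (S \<inter> (\<lambda>x. f x - V k x) -` {e..})"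
      by (intro continuous_closedin_preimage continuous_on_diff f V) auto
    then have "compact (S \<inter> (\<lambda>x. f x - V k x) -` {e..})"
      using S closedin_compact by blast
    moreover have "S \<inter> (\<lambda>x. f x - V k x) -` {e..} = {x\<in>S. e \<le> f x - V k x}" by auto
    ultimately show ?thesis by simp
  qed
  moreover have "{x\<in>S. e \<le> f x - V m x} \<subseteq> {x\<in>S. e \<le> f x - V k x}" if "k \<le> m" for k m
    using incseqD[OF mono that] by force
  ultimately have "(\<Inter>k. {x\<in>S. e \<le> f x - V k x}) \<noteq> {}"
    using ne by (intro compact_nest) simp_all
  then obtain x where x: "x \<in> S" "\<And>k. e \<le> f x - V k x" by auto
  have "(\<lambda>k. f x - V k x) \<longlonglongrightarrow> f x - f x"
    by (intro tendsto_intros lim x)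
  then have "e \<le> f x - f x"
    by (rule LIMSEQ_le_const) (use x in auto)
  with e show False by simp
qed

text \<open>If \<open>D\<close> were negative, \<open>g'\<close> would be negative just to the right
  of its zero at 0, and the mean value theorem would push \<open>g\<close> below its
  minimum.\<close>

lemma second_derivative_local_min:
  fixes g g' :: "real \<Rightarrow> real"
  assumes g: "\<And>s. (g has_real_derivative g' s) (at s)"
    and D: "(g' has_real_derivative D) (at 0)"
    and d: "d > 0" and min: "\<And>s. \<bar>s\<bar> < d \<Longrightarrow> g 0 \<le> g s"
  shows "g' 0 = 0" "0 \<le> D"
proof -
  show g0: "g' 0 = 0"
    using DERIV_local_min[OF g d] min by auto
  show "0 \<le> D"
  proof (rule ccontr)
    assume "\<not> 0 \<le> D"
    then obtain d' where d': "d' > 0" "\<And>h. 0 < h \<Longrightarrow> h < d' \<Longrightarrow> g' (0 + h) < g' 0"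
      using DERIV_neg_dec_right[OF D] by auto
    define h where "h = min d d' / 2"
    have h: "0 < h" "h < d" "h < d'"
      using d d' by (auto simp: h_def min_def)
    obtain z where "0 < z" "z < h" "g h - g 0 = (h - 0) * g' z"
      using MVT2[of 0 h g g'] g h by auto
    with d'(2)[of z] h g0 have "g h < g 0"
      using mult_pos_neg[of h "g' z"] by simp
    with min[of h] h show False by auto
  qed
qed

text \<open>The second-order inequality survives the limit although no derivatives of the \<open>V k\<close> are
  known to converge: it is tested at interior minima of \<open>V k - f + d |x - p|\<^sup>2\<close> near \<open>p\<close>, as
  for viscosity solutions.\<close>
lemma hess_inequality_limit:
  fixes f :: "real ^ 'n::finite \<Rightarrow> real" and V :: "nat \<Rightarrow> real ^ 'n \<Rightarrow> real"
  assumes f: "smooth f" and c: "c \<ge> 0"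
    and V: "\<And>k. continuous_on UNIV (V k)"
    and V1: "\<And>k x a s. ((\<lambda>s. V k (x + s *\<^sub>R a)) has_real_derivative G k (x + s *\<^sub>R a) a) (at s)"
    and V2: "\<And>k x a s. ((\<lambda>s. G k (x + s *\<^sub>R a) a) has_real_derivative H k (x + s *\<^sub>R a) a) (at s)"
    and ineq: "\<And>k x. H k x a + H k x b + c * (G k x w)\<^sup>2 \<le> 0"
    and mono: "\<And>x. incseq (\<lambda>k. V k x)"
    and lim: "\<And>x. (\<lambda>k. V k x) \<longlonglongrightarrow> f x"
  shows "hess f p a + hess f p b + c * (grad f p \<bullet> w)\<^sup>2 \<le> 0"
proof (rule ccontr)
  assume contra: "\<not> ?thesis"
  \<comment> \<open>\<open>\<Phi> (d, x)\<close> is the left side of the claim at \<open>x\<close>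
    for \<open>f - d |x - p|^2\<close> in place of \<open>f\<close>. It is positive at
    \<open>(0, p)\<close> by contradiction hypothesis, hence nearby.\<close>
  define \<Phi> where "\<Phi> = (\<lambda>(d, x). hess f x a - 2 * d * (a \<bullet> a) + (hess f x b - 2 * d * (b \<bullet> b))
    + c * (grad f x \<bullet> w - 2 * d * ((x - p) \<bullet> w))\<^sup>2)"
  have "continuous_on UNIV \<Phi>"
    unfolding \<Phi>_def split_beta
    by (intro continuous_intros
        continuous_on_compose2[OF continuous_on_hess[OF f, of UNIV] continuous_on_snd]
        continuous_on_compose2[OF continuous_on_grad[OF f, of UNIV] continuous_on_snd]) auto
  then have "isCont \<Phi> (0, p)"
    by (simp add: continuous_on_eq_continuous_at)
  moreover have "\<Phi> (0, p) > 0"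
    using contra by (simp add: \<Phi>_def)
  ultimately have "\<forall>\<^sub>F z in nhds (0, p). \<Phi> z > 0"
    unfolding isCont_def tendsto_at_iff_tendsto_nhds by (rule order_tendstoD)
  then obtain r0 where r0: "r0 > 0" "\<And>z. dist z (0, p) < r0 \<Longrightarrow> \<Phi> z > 0"
    by (auto simp: eventually_nhds_metric)
  \<comment> \<open>The same \<open>r\<close> serves as radius of the ball and as coefficient of the
    penalty; each takes half of the distance \<open>r0\<close>.\<close>
  define r where "r = r0 / 2"
  have r: "r > 0" using r0 by (simp add: r_def)
  have pos: "\<Phi> (r, x) > 0" if "dist x p < r" for x
  proof (rule r0)
    have "dist (r, x) (0, p) \<le> dist r 0 + dist x p"
      using sqrt_sum_squares_le_sum[of "dist r 0" "dist x p"] by (simp add: dist_Pair_Pair)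
    with that r show "dist (r, x) (0, p) < r0"
      by (simp add: r_def)
  qed
  \<comment> \<open>\<open>r * r^2\<close> is the value of the penalty \<open>r |x - p|^2\<close> on
    the boundary sphere. With the gap below it, \<open>F\<close> is positive there, while
    \<open>F p\<close> is at most 0 because \<open>V k\<close> increases to \<open>f\<close>; so the
    minimum of \<open>F\<close> is interior.\<close>
  have "\<exists>k. \<forall>x\<in>cball p r. f x - V k x < r * r\<^sup>2"
    using r by (intro Dini_compact lim mono continuous_on_subset[OF V] smooth_continuous[OF f]) auto
  then obtain k where k: "\<And>x. x \<in> cball p r \<Longrightarrow> f x - V k x < r * r\<^sup>2" by blast
  define F where "F x = V k x - f x + r * ((x - p) \<bullet> (x - p))" for x
  have "continuous_on (cball p r) F"
    unfolding F_def by (intro continuous_intros continuous_on_subset[OF V] smooth_continuous[OF f]) auto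
  then obtain x0 where x0: "x0 \<in> cball p r" "\<And>x. x \<in> cball p r \<Longrightarrow> F x0 \<le> F x"
    using continuous_attains_inf[of "cball p r" F] r by auto
  have "V k p \<le> f p"
    using incseq_le[OF mono lim] .
  then have Fp: "F x0 \<le> 0"
    using x0(2)[of p] r by (simp add: F_def)
  have x0r: "dist x0 p < r"
  proof (rule ccontr)
    assume "\<not> dist x0 p < r"
    then have "norm (x0 - p) = r"
      using x0(1) by (simp add: dist_norm norm_minus_commute)
    then have "(x0 - p) \<bullet> (x0 - p) = r\<^sup>2" by (simp add: dot_square_norm)
    with k[OF x0(1)] Fp show False by (simp add: F_def)
  qed
  \<comment> \<open>Along every line through the interior minimum \<open>x0\<close>, the first
    derivatives of \<open>V k\<close> and \<open>f - r |x - p|^2\<close> agree, and the second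
    derivative of \<open>V k\<close> is at least that of the comparison function. This bounds
    \<open>\<Phi> (r, x0)\<close> by the left side of \<open>ineq\<close>.\<close>
  have min: "G k x0 v - grad f x0 \<bullet> v + 2 * r * ((x0 - p) \<bullet> v) = 0"
    "0 \<le> H k x0 v - hess f x0 v + 2 * r * (v \<bullet> v)" for v
  proof -
    let ?g = "\<lambda>s. F (x0 + s *\<^sub>R v)"
    let ?g' = "\<lambda>s. G k (x0 + s *\<^sub>R v) v - grad f (x0 + s *\<^sub>R v) \<bullet> v + 2 * r * ((x0 + s *\<^sub>R v - p) \<bullet> v)"
    have lin: "((\<lambda>s. (x0 + s *\<^sub>R v - p) \<bullet> v) has_real_derivative v \<bullet> v) (at s)" for s
      by (simp add: inner_diff_left inner_add_left) (auto intro!: derivative_eq_intros)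
    have quad: "((\<lambda>s. r * ((x0 + s *\<^sub>R v - p) \<bullet> (x0 + s *\<^sub>R v - p))) has_real_derivative
        2 * r * ((x0 + s *\<^sub>R v - p) \<bullet> v)) (at s)" for s
    proof -
      have "(x0 + s *\<^sub>R v - p) \<bullet> (x0 + s *\<^sub>R v - p) =
          (x0 - p) \<bullet> (x0 - p) + 2 * s * ((x0 - p) \<bullet> v) + s\<^sup>2 * (v \<bullet> v)" for s
        by (simp add: inner_diff_left inner_diff_right inner_add_left inner_add_right
          inner_commute power2_eq_square algebra_simps)
      then show ?thesis
        by (simp add: inner_diff_left inner_add_left)
          (auto intro!: derivative_eq_intros simp: algebra_simps inner_diff_left)
    qed
    have g: "(?g has_real_derivative ?g' s) (at s)" for s
      unfolding F_def by (intro DERIV_add DERIV_diff V1 smooth_line_deriv[OF f] quad)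
    have g': "(?g' has_real_derivative H k (x0 + 0 *\<^sub>R v) v - hess f (x0 + 0 *\<^sub>R v) v + 2 * r * (v \<bullet> v)) (at 0)"
      by (intro DERIV_add DERIV_diff V2 smooth_line_deriv2[OF f] DERIV_cmult lin)
    define d where "d = (r - dist x0 p) / (norm v + 1)"
    have d: "d > 0" using x0r by (auto simp: d_def intro!: divide_pos_pos add_nonneg_pos)
    have le: "?g 0 \<le> ?g s" if "\<bar>s\<bar> < d" for s
    proof -
      have "\<bar>s\<bar> * norm v \<le> \<bar>s\<bar> * (norm v + 1)" by (simp add: mult_left_mono)
      also have "\<dots> < d * (norm v + 1)" using that by (intro mult_strict_right_mono) (auto intro: add_nonneg_pos)
      also have "\<dots> = r - dist x0 p"
        unfolding d_def by (metis add_nonneg_eq_0_iff divide_self_if nonzero_eq_divide_eq norm_ge_zero times_divide_eq_left zero_le_one zero_neq_one)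
      finally have "norm (s *\<^sub>R v) < r - dist x0 p" by simp
      moreover have "dist p (x0 + s *\<^sub>R v) \<le> dist p x0 + norm (s *\<^sub>R v)"
        using dist_triangle[of p "x0 + s *\<^sub>R v" x0] by (simp add: dist_norm)
      ultimately have "x0 + s *\<^sub>R v \<in> cball p r" by (simp add: dist_commute)
      from x0(2)[OF this] show ?thesis by simp
    qed
    show "G k x0 v - grad f x0 \<bullet> v + 2 * r * ((x0 - p) \<bullet> v) = 0"
      using second_derivative_local_min(1)[OF g g' d le] by simp
    show "0 \<le> H k x0 v - hess f x0 v + 2 * r * (v \<bullet> v)"
      using second_derivative_local_min(2)[OF g g' d le] by simp
  qed
  have "grad f x0 \<bullet> w - 2 * r * ((x0 - p) \<bullet> w) = G k x0 w"
    using min(1)[of w] by linarith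
  then have "\<Phi> (r, x0) \<le> H k x0 a + H k x0 b + c * (G k x0 w)\<^sup>2"
    using min(2)[of a] min(2)[of b] by (simp add: \<Phi>_def)
  with ineq[of k x0] pos[OF x0r] show False by linarith
qed

subsection \<open>Regularised logarithmic potentials\<close>

text \<open>The mean value theorem bounds all difference quotients by \<open>B\<close>, so dominated
  convergence applies along every sequence tending to \<open>s\<close>.\<close>

lemma has_real_derivative_integral:
  fixes k k' :: "real \<Rightarrow> 'a \<Rightarrow> real"
  assumes k: "\<And>s. integrable M (k s)"
    and k': "\<And>s y. y \<in> space M \<Longrightarrow> ((\<lambda>s. k s y) has_real_derivative k' s y) (at s)"
    and meas: "\<And>s. k' s \<in> borel_measurable M"
    and B: "integrable M B" "\<And>s y. y \<in> space M \<Longrightarrow> \<bar>k' s y\<bar> \<le> B y"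
  shows "((\<lambda>s. \<integral>y. k s y \<partial>M) has_real_derivative (\<integral>y. k' s y \<partial>M)) (at s)"
  unfolding has_field_derivative_iff tendsto_at_iff_sequentially
proof (intro allI impI)
  fix X :: "nat \<Rightarrow> real"
  assume X: "\<forall>i. X i \<in> UNIV - {s}" and lim: "X \<longlonglongrightarrow> s"
  have "(\<lambda>i. \<integral>y. (k (X i) y - k s y) / (X i - s) \<partial>M) \<longlonglongrightarrow> (\<integral>y. k' s y \<partial>M)"
  proof (rule integral_dominated_convergence[where w = B])
    show "AE y in M. (\<lambda>i. (k (X i) y - k s y) / (X i - s)) \<longlonglongrightarrow> k' s y"
    proof (rule AE_I2)
      fix y assume "y \<in> space M"
      from k'[OF this, of s] X lim show "(\<lambda>i. (k (X i) y - k s y) / (X i - s)) \<longlonglongrightarrow> k' s y"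
        unfolding has_field_derivative_iff tendsto_at_iff_sequentially by (auto simp: o_def)
    qed
    show "AE y in M. norm ((k (X i) y - k s y) / (X i - s)) \<le> B y" for i
    proof (rule AE_I2)
      fix y assume y: "y \<in> space M"
      have "norm (k (X i) y - k s y) \<le> B y * norm (X i - s)"
        by (rule field_differentiable_bound[where S = UNIV and f' = "\<lambda>s. k' s y"])
          (use k'[OF y] B(2)[OF y] in auto)
      then show "norm ((k (X i) y - k s y) / (X i - s)) \<le> B y"
        using X by (simp add: divide_simps)
    qed
  qed (use k meas B(1) in \<open>auto intro!: borel_measurable_divide borel_measurable_diff\<close>)
  then show "((\<lambda>z. ((\<integral>y. k z y \<partial>M) - (\<integral>y. k s y \<partial>M)) / (z - s)) \<circ> X) \<longlonglongrightarrow> (\<integral>y. k' s y \<partial>M)"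
    using k by (simp add: o_def)
qed

lemma integrable_bounded_mult:
  fixes f h :: "'a \<Rightarrow> real"
  assumes h: "integrable M h" and [measurable]: "f \<in> borel_measurable M"
    and B: "\<And>y. \<bar>f y\<bar> \<le> B"
  shows "integrable M (\<lambda>y. f y * h y)"
proof (rule Bochner_Integration.integrable_bound[where f = "\<lambda>y. B * h y"])
  have [measurable]: "h \<in> borel_measurable M" using h by auto
  show "(\<lambda>y. f y * h y) \<in> borel_measurable M" by simp
  show "AE y in M. norm (f y * h y) \<le> norm (B * h y)"
    using order_trans[OF B abs_ge_self] by (auto simp: abs_mult intro!: mult_right_mono)
qed (use h in auto)

text \<open>The weight \<open>ln (1 + |y|\<^sup>2) / 2\<close> replaces \<open>ln |y|\<close>: it behaves alike at infinity, so that
  the kernel stays bounded for large \<open>y\<close>, but has no singularity at the origin.\<close>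
definition log_kernel :: "real ^ 'n::finite \<Rightarrow> real ^ 'n \<Rightarrow> real" where
  "log_kernel x y = ln (1 + (norm y)\<^sup>2) / 2 - ln (norm (x - y))"

text \<open>For \<open>e > 0\<close> the kernel is smooth in \<open>x\<close>, also at
  \<open>x = y\<close>, and off the diagonal it increases to \<open>log_kernel x y\<close> as
  \<open>e\<close> decreases to 0.\<close>

definition reg_kernel :: "real \<Rightarrow> real ^ 'n::finite \<Rightarrow> real ^ 'n \<Rightarrow> real" where
  "reg_kernel e x y = ln (1 + (norm y)\<^sup>2) / 2 - ln ((norm (x - y))\<^sup>2 + e) / 2"

definition reg_potential :: "(real ^ 'n::finite \<Rightarrow> real) \<Rightarrow> real \<Rightarrow> real ^ 'n \<Rightarrow> real" where
  "reg_potential h e x = (\<integral>y. reg_kernel e x y * h y \<partial>lborel)"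

lemma borel_measurable_log_kernel [measurable]: "log_kernel x \<in> borel_measurable borel"
  unfolding log_kernel_def by simp

lemma borel_measurable_reg_kernel [measurable]: "reg_kernel e x \<in> borel_measurable borel"
  unfolding reg_kernel_def by simp

lemma norm_sq_le: "(norm y)\<^sup>2 \<le> 2 * (norm x)\<^sup>2 + 2 * (norm (x - y))\<^sup>2"
  for x y :: "'a::real_inner"
proof -
  have "(norm y)\<^sup>2 = (norm (x - (x - y)))\<^sup>2" by simp
  also have "\<dots> \<le> (norm x + norm (x - y))\<^sup>2"
    by (intro power_mono norm_triangle_ineq4) auto
  also have "\<dots> \<le> 2 * (norm x)\<^sup>2 + 2 * (norm (x - y))\<^sup>2"
    using sum_squares_bound[of "norm x" "norm (x - y)"] by (simp add: power2_sum)
  finally show ?thesis .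
qed

text \<open>For fixed \<open>x\<close> the quantities \<open>1 + |y|^2\<close> and
  \<open>|x - y|^2 + e\<close> bound each other up to the constant factors \<open>A1\<close> and
  \<open>A2\<close>, so their logarithms differ by a bounded amount.\<close>

lemma reg_kernel_bounded:
  assumes e: "e > 0"
  shows "\<exists>B. \<forall>y. \<bar>reg_kernel e x y\<bar> \<le> B"
proof -
  define A1 where "A1 = 2 + (1 + 2 * (norm x)\<^sup>2) / e"
  define A2 where "A2 = 2 * (norm x)\<^sup>2 + 2 + e"
  have A: "A1 \<ge> 1" "A2 \<ge> 1" using e by (auto simp: A1_def A2_def intro: add_increasing2)
  have "\<bar>reg_kernel e x y\<bar> \<le> (ln A1 + ln A2) / 2" for y
  proof -
    define D where "D = (norm (x - y))\<^sup>2 + e"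
    have D: "D > 0" "D \<ge> e" using e by (auto simp: D_def intro: add_nonneg_pos)
    have "1 + (norm y)\<^sup>2 \<le> 1 + 2 * (norm x)\<^sup>2 + 2 * D"
      using norm_sq_le[of y x] e by (simp add: D_def)
    also have "1 + 2 * (norm x)\<^sup>2 \<le> (1 + 2 * (norm x)\<^sup>2) / e * D"
    proof -
      have "(1 + 2 * (norm x)\<^sup>2) * e \<le> (1 + 2 * (norm x)\<^sup>2) * D"
        using D by (intro mult_left_mono) auto
      then show ?thesis using e by (simp add: pos_le_divide_eq)
    qed
    finally have "1 + (norm y)\<^sup>2 \<le> A1 * D"
      by (simp add: A1_def algebra_simps)
    then have "ln (1 + (norm y)\<^sup>2) \<le> ln A1 + ln D"
      using D A by (subst ln_mult_pos[symmetric]) (auto intro!: ln_mono add_pos_nonneg)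
    moreover have "D \<le> A2 * (1 + (norm y)\<^sup>2)"
    proof -
      have "D \<le> 2 * (norm x)\<^sup>2 + 2 * (norm y)\<^sup>2 + e"
        using norm_sq_le[of "x - y" x] by (simp add: D_def)
      also have "\<dots> \<le> A2 * (1 + (norm y)\<^sup>2)"
        using e by (simp add: A2_def algebra_simps)
      finally show ?thesis .
    qed
    then have "ln D \<le> ln A2 + ln (1 + (norm y)\<^sup>2)"
      using D A by (subst ln_mult_pos[symmetric]) (auto intro!: ln_mono add_pos_nonneg)
    moreover have "\<bar>P / 2 - Q / 2\<bar> \<le> (c + d) / 2"
      if "P \<le> c + Q" "Q \<le> d + P" "0 \<le> c" "0 \<le> d" for P Q c d :: real
      using that by (auto simp: abs_le_iff field_simps)
    ultimately show ?thesis
      using ln_ge_zero[OF A(1)] ln_ge_zero[OF A(2)]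
      unfolding reg_kernel_def D_def by blast
  qed
  then show ?thesis by blast
qed

lemma integrable_reg_kernel:
  assumes "integrable lborel h" "e > 0"
  shows "integrable lborel (\<lambda>y. reg_kernel e x y * h y)"
  using reg_kernel_bounded[OF assms(2), of x] by (auto intro: integrable_bounded_mult[OF assms(1)])

section \<open>Derivatives of the regularised potential\<close>

definition reg_grad :: "(real ^ 'n::finite \<Rightarrow> real) \<Rightarrow> real \<Rightarrow> real ^ 'n \<Rightarrow> real ^ 'n \<Rightarrow> real" where
  "reg_grad h e x a = (\<integral>y. - ((x - y) \<bullet> a) / ((norm (x - y))\<^sup>2 + e) * h y \<partial>lborel)"

definition reg_hess :: "(real ^ 'n::finite \<Rightarrow> real) \<Rightarrow> real \<Rightarrow> real ^ 'n \<Rightarrow> real ^ 'n \<Rightarrow> real" where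
  "reg_hess h e x a = (\<integral>y. (2 * ((x - y) \<bullet> a)\<^sup>2 / ((norm (x - y))\<^sup>2 + e)\<^sup>2
     - (norm a)\<^sup>2 / ((norm (x - y))\<^sup>2 + e)) * h y \<partial>lborel)"

lemma reg_grad_kernel_bound:
  fixes z a :: "'a::real_inner"
  assumes e: "e > 0"
  shows "\<bar>- (z \<bullet> a) / ((norm z)\<^sup>2 + e)\<bar> \<le> norm a * (1 + 1 / e)"
proof -
  have pos: "(norm z)\<^sup>2 + e > 0" using e by (auto intro: add_nonneg_pos)
  have "\<bar>z \<bullet> a\<bar> \<le> norm a * norm z"
    using Cauchy_Schwarz_ineq2[of z a] by (simp add: mult.commute)
  also have "norm z \<le> (1 + 1 / e) * ((norm z)\<^sup>2 + e)"
  proof -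
    have "norm z \<le> (norm z)\<^sup>2 + 1"
      using zero_le_power2[of "norm z - 1"] norm_ge_zero[of z] by (simp add: power2_diff del: norm_ge_zero)
    also have "\<dots> \<le> (1 + 1 / e) * ((norm z)\<^sup>2 + e)"
      using e by (simp add: field_simps)
    finally show ?thesis .
  qed
  finally have "\<bar>z \<bullet> a\<bar> \<le> norm a * (1 + 1 / e) * ((norm z)\<^sup>2 + e)"
    by (simp add: mult_left_mono mult.assoc)
  then show ?thesis using pos by (simp add: abs_divide pos_divide_le_eq)
qed

lemma reg_hess_kernel_bound:
  fixes z a :: "'a::real_inner"
  assumes e: "e > 0"
  shows "\<bar>2 * (z \<bullet> a)\<^sup>2 / ((norm z)\<^sup>2 + e)\<^sup>2 - (norm a)\<^sup>2 / ((norm z)\<^sup>2 + e)\<bar> \<le> 3 * (norm a)\<^sup>2 / e"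
proof -
  define D where "D = (norm z)\<^sup>2 + e"
  have D: "D > 0" "D \<ge> e" "D \<ge> (norm z)\<^sup>2" using e by (auto simp: D_def intro: add_nonneg_pos)
  have "(z \<bullet> a)\<^sup>2 \<le> (norm z)\<^sup>2 * (norm a)\<^sup>2"
    using Cauchy_Schwarz_ineq[of z a] by (simp add: dot_square_norm)
  also have "\<dots> \<le> D * (norm a)\<^sup>2" using D by (intro mult_right_mono) auto
  finally have "(z \<bullet> a)\<^sup>2 / D\<^sup>2 \<le> D * (norm a)\<^sup>2 / D\<^sup>2"
    by (rule divide_right_mono) simp
  also have "\<dots> = (norm a)\<^sup>2 / D"
    using D by (simp add: power2_eq_square)
  finally have "(z \<bullet> a)\<^sup>2 / D\<^sup>2 \<le> (norm a)\<^sup>2 / D" .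
  moreover have "(norm a)\<^sup>2 / D \<le> (norm a)\<^sup>2 / e" using D e by (intro divide_left_mono) auto
  moreover have "0 \<le> (z \<bullet> a)\<^sup>2 / D\<^sup>2" "0 \<le> (norm a)\<^sup>2 / D" using D by auto
  ultimately have "\<bar>2 * ((z \<bullet> a)\<^sup>2 / D\<^sup>2) - (norm a)\<^sup>2 / D\<bar> \<le> 3 * ((norm a)\<^sup>2 / e)" by linarith
  then show ?thesis by (simp add: D_def)
qed

lemma integrable_reg_grad_kernel:
  assumes "integrable lborel h" "e > 0"
  shows "integrable lborel (\<lambda>y. - ((x - y) \<bullet> a) / ((norm (x - y))\<^sup>2 + e) * h y)"
  by (rule integrable_bounded_mult[OF assms(1) _ reg_grad_kernel_bound[OF assms(2)]]) simp

lemma integrable_reg_hess_kernel: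
  assumes "integrable lborel h" "e > 0"
  shows "integrable lborel (\<lambda>y. (2 * ((x - y) \<bullet> a)\<^sup>2 / ((norm (x - y))\<^sup>2 + e)\<^sup>2
     - (norm a)\<^sup>2 / ((norm (x - y))\<^sup>2 + e)) * h y)"
  by (rule integrable_bounded_mult[OF assms(1) _ reg_hess_kernel_bound[OF assms(2)]]) simp

lemma has_derivative_norm_sq_line:
  fixes x a :: "'a::real_inner"
  shows "((\<lambda>s. (norm (x + s *\<^sub>R a - y))\<^sup>2) has_real_derivative 2 * ((x + s *\<^sub>R a - y) \<bullet> a)) (at s)"
proof -
  have "(\<lambda>s. (norm (x + s *\<^sub>R a - y))\<^sup>2) =
      (\<lambda>s. (x - y) \<bullet> (x - y) + 2 * s * ((x - y) \<bullet> a) + s\<^sup>2 * (a \<bullet> a))"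
    unfolding power2_norm_eq_inner
    by (simp add: inner_diff_left inner_diff_right inner_add_left
      inner_add_right inner_commute power2_eq_square algebra_simps)
  moreover have "((\<lambda>s. (x - y) \<bullet> (x - y) + 2 * s * ((x - y) \<bullet> a) + s\<^sup>2 * (a \<bullet> a))
      has_real_derivative 2 * ((x + s *\<^sub>R a - y) \<bullet> a)) (at s)"
    by (auto intro!: derivative_eq_intros simp: inner_diff_left inner_add_left algebra_simps)
  ultimately show ?thesis by simp
qed

lemma reg_potential_line_deriv:
  assumes h: "integrable lborel h" and e: "e > 0"
  shows "((\<lambda>s. reg_potential h e (x + s *\<^sub>R a)) has_real_derivative reg_grad h e (x + s *\<^sub>R a) a) (at s)"
  unfolding reg_potential_def reg_grad_def
proof (rule has_real_derivative_integral[where B = "\<lambda>y. norm a * (1 + 1 / e) * \<bar>h y\<bar>"])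
  fix s y
  have pos: "(norm (x + s *\<^sub>R a - y))\<^sup>2 + e > 0" using e by (auto intro: add_nonneg_pos)
  show "((\<lambda>s. reg_kernel e (x + s *\<^sub>R a) y * h y) has_real_derivative
      - ((x + s *\<^sub>R a - y) \<bullet> a) / ((norm (x + s *\<^sub>R a - y))\<^sup>2 + e) * h y) (at s)"
  proof (rule DERIV_cmult_right)
    have "((\<lambda>s. (norm (x + s *\<^sub>R a - y))\<^sup>2 + e) has_real_derivative
        2 * ((x + s *\<^sub>R a - y) \<bullet> a)) (at s)"
      by (rule DERIV_cong[OF DERIV_add[OF has_derivative_norm_sq_line DERIV_const]]) simp
    from DERIV_chain2[OF DERIV_ln_divide[OF pos] this]
    show "((\<lambda>s. reg_kernel e (x + s *\<^sub>R a) y) has_real_derivative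
        - ((x + s *\<^sub>R a - y) \<bullet> a) / ((norm (x + s *\<^sub>R a - y))\<^sup>2 + e)) (at s)"
      unfolding reg_kernel_def
      by (intro DERIV_cong[OF DERIV_diff[OF DERIV_const DERIV_cdivide]]) (auto simp: mult.commute)
  qed
  show "\<bar>- ((x + s *\<^sub>R a - y) \<bullet> a) / ((norm (x + s *\<^sub>R a - y))\<^sup>2 + e) * h y\<bar>
      \<le> norm a * (1 + 1 / e) * \<bar>h y\<bar>"
    unfolding abs_mult by (intro mult_right_mono reg_grad_kernel_bound e) auto
qed (use h e in \<open>auto intro!: integrable_reg_kernel borel_measurable_integrable integrable_reg_grad_kernel\<close>)

lemma reg_grad_line_deriv:
  assumes h: "integrable lborel h" and e: "e > 0"
  shows "((\<lambda>s. reg_grad h e (x + s *\<^sub>R a) a) has_real_derivative reg_hess h e (x + s *\<^sub>R a) a) (at s)"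
  unfolding reg_hess_def reg_grad_def
proof (rule has_real_derivative_integral[where B = "\<lambda>y. 3 * (norm a)\<^sup>2 / e * \<bar>h y\<bar>"])
  fix s y
  define D where "D s = (norm (x + s *\<^sub>R a - y))\<^sup>2 + e" for s
  have pos: "D s > 0" using e by (auto simp: D_def intro: add_nonneg_pos)
  have D: "(D has_real_derivative 2 * ((x + s *\<^sub>R a - y) \<bullet> a)) (at s)"
    unfolding D_def
    by (rule DERIV_cong[OF DERIV_add[OF has_derivative_norm_sq_line DERIV_const]]) simp
  have lin: "((\<lambda>s. (x + s *\<^sub>R a - y) \<bullet> a) has_real_derivative (norm a)\<^sup>2) (at s)"
    by (simp add: inner_diff_left inner_add_left power2_norm_eq_inner)
      (auto intro!: derivative_eq_intros)
  have "((\<lambda>s. - ((x + s *\<^sub>R a - y) \<bullet> a) / D s) has_real_derivative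
      2 * ((x + s *\<^sub>R a - y) \<bullet> a)\<^sup>2 / (D s)\<^sup>2 - (norm a)\<^sup>2 / D s) (at s)"
    by (rule DERIV_cong[OF DERIV_divide[OF DERIV_minus[OF lin] D]])
      (use pos in \<open>auto simp: field_simps power2_eq_square\<close>)
  then show "((\<lambda>s. - ((x + s *\<^sub>R a - y) \<bullet> a) / ((norm (x + s *\<^sub>R a - y))\<^sup>2 + e) * h y)
      has_real_derivative (2 * ((x + s *\<^sub>R a - y) \<bullet> a)\<^sup>2 / ((norm (x + s *\<^sub>R a - y))\<^sup>2 + e)\<^sup>2
     - (norm a)\<^sup>2 / ((norm (x + s *\<^sub>R a - y))\<^sup>2 + e)) * h y) (at s)"
    unfolding D_def by (rule DERIV_cmult_right)
  show "\<bar>(2 * ((x + s *\<^sub>R a - y) \<bullet> a)\<^sup>2 / ((norm (x + s *\<^sub>R a - y))\<^sup>2 + e)\<^sup>2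
     - (norm a)\<^sup>2 / ((norm (x + s *\<^sub>R a - y))\<^sup>2 + e)) * h y\<bar> \<le> 3 * (norm a)\<^sup>2 / e * \<bar>h y\<bar>"
    unfolding abs_mult by (intro mult_right_mono reg_hess_kernel_bound e) auto
  show "integrable lborel (\<lambda>y. - ((x + s *\<^sub>R a - y) \<bullet> a) / ((norm (x + s *\<^sub>R a - y))\<^sup>2 + e) * h y)"
    by (rule integrable_reg_grad_kernel[OF h e])
qed (use h e in \<open>auto intro!: borel_measurable_integrable integrable_reg_hess_kernel\<close>)

text \<open>Supplies the continuity of the regularised potential: its directional derivatives are
  bounded uniformly in \<open>x\<close>, and the mean value inequality along segments does the
  rest.\<close>

lemma reg_potential_lipschitz:
  assumes h: "integrable lborel h" and e: "e > 0"
  shows "\<exists>L. L-lipschitz_on UNIV (reg_potential h e)"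
proof -
  define L where "L = (1 + 1 / e) * (\<integral>y. \<bar>h y\<bar> \<partial>lborel)"
  have L0: "L \<ge> 0" using e by (simp add: L_def)
  have grad: "\<bar>reg_grad h e x a\<bar> \<le> norm a * L" for x a
  proof -
    have "\<bar>reg_grad h e x a\<bar> \<le> (\<integral>y. norm a * (1 + 1 / e) * \<bar>h y\<bar> \<partial>lborel)"
      unfolding reg_grad_def
    proof (rule order_trans[OF integral_abs_bound integral_mono])
      show "\<bar>- ((x - y) \<bullet> a) / ((norm (x - y))\<^sup>2 + e) * h y\<bar> \<le> norm a * (1 + 1 / e) * \<bar>h y\<bar>" for y
        unfolding abs_mult by (intro mult_right_mono reg_grad_kernel_bound e) auto
      show "integrable lborel (\<lambda>y. \<bar>- ((x - y) \<bullet> a) / ((norm (x - y))\<^sup>2 + e) * h y\<bar>)"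
        by (rule integrable_abs[OF integrable_reg_grad_kernel[OF h e]])
    qed (use h in auto)
    then show ?thesis by (simp add: L_def)
  qed
  have "dist (reg_potential h e x) (reg_potential h e y) \<le> L * dist x y" for x y
  proof -
    have "norm (reg_potential h e (x + 1 *\<^sub>R (y - x)) - reg_potential h e (x + 0 *\<^sub>R (y - x)))
        \<le> norm (y - x) * L * norm (1 - 0 :: real)"
      by (rule field_differentiable_bound[where S = UNIV])
        (use reg_potential_line_deriv[OF h e] grad in auto)
    then show ?thesis
      by (simp add: dist_norm norm_minus_commute abs_minus_commute mult.commute)
  qed
  with L0 show ?thesis by (auto simp: lipschitz_on_def)
qed

text \<open>Cauchy--Schwarz for \<open>h dy\<close> in the form \<open>\<integral>(q - l)\<^sup>2 h \<ge> 0\<close> with \<open>l = c / 2 * \<integral>q h\<close>.\<close>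
lemma reg_hess_inequality:
  assumes h: "integrable lborel h" "\<And>y. h y \<ge> 0" and e: "e > 0"
    and c: "c \<ge> 0" "c * (\<integral>y. h y \<partial>lborel) \<le> 2"
    and ab: "norm a = 1" "norm b = 1" "a \<bullet> b = 0" and w: "norm w \<le> 1" "w \<bullet> a = 0" "w \<bullet> b = 0"
  shows "reg_hess h e x a + reg_hess h e x b + c * (reg_grad h e x w)\<^sup>2 \<le> 0"
proof -
  define q where "q y = - ((x - y) \<bullet> w) / ((norm (x - y))\<^sup>2 + e)" for y
  define j where "j = (\<integral>y. q y * h y \<partial>lborel)"
  define m where "m = (\<integral>y. h y \<partial>lborel)"
  have [measurable]: "q \<in> borel_measurable borel" unfolding q_def by simp
  have qh: "integrable lborel (\<lambda>y. q y * h y)"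
    unfolding q_def by (rule integrable_reg_grad_kernel[OF h(1) e])
  have qb: "\<bar>(q y)\<^sup>2\<bar> \<le> (norm w * (1 + 1 / e))\<^sup>2" for y
    using power_mono[OF reg_grad_kernel_bound[OF e, of "x - y" w] abs_ge_zero, of 2]
    by (simp add: q_def power_divide)
  have q2h: "integrable lborel (\<lambda>y. (q y)\<^sup>2 * h y)"
    by (rule integrable_bounded_mult[OF h(1) _ qb]) simp
  \<comment> \<open>Only the component \<open>z'\<close> of \<open>z\<close> orthogonal to
    \<open>a\<close> and \<open>b\<close> is seen by \<open>w\<close>; Cauchy-Schwarz and Pythagoras
    finish.\<close>
  have perp: "(z \<bullet> w)\<^sup>2 \<le> (norm z)\<^sup>2 - (z \<bullet> a)\<^sup>2 - (z \<bullet> b)\<^sup>2" for z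
  proof -
    define z' where "z' = z - (z \<bullet> a) *\<^sub>R a - (z \<bullet> b) *\<^sub>R b"
    have aa: "a \<bullet> a = 1" "b \<bullet> b = 1" using ab by (auto simp: dot_square_norm)
    have "z \<bullet> w = z' \<bullet> w" using w by (simp add: z'_def inner_diff_right inner_commute[of _ w])
    then have "(z \<bullet> w)\<^sup>2 \<le> (z' \<bullet> z') * (w \<bullet> w)" by (simp add: Cauchy_Schwarz_ineq)
    also have "\<dots> \<le> (z' \<bullet> z') * 1"
      using w by (intro mult_left_mono) (auto simp: dot_square_norm power_le_one)
    also have "z' \<bullet> z' = (norm z)\<^sup>2 - (z \<bullet> a)\<^sup>2 - (z \<bullet> b)\<^sup>2"
      unfolding power2_norm_eq_inner
      using aa ab by (simp add: z'_def inner_diff_left inner_diff_right inner_commute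
        power2_eq_square algebra_simps)
    finally show ?thesis by simp
  qed
  have "reg_hess h e x a + reg_hess h e x b \<le> (\<integral>y. - 2 * ((q y)\<^sup>2 * h y) \<partial>lborel)"
    unfolding reg_hess_def
  proof (subst Bochner_Integration.integral_add[symmetric], goal_cases)
    case 3
    show ?case
    proof (rule integral_mono)
      fix y
      define D where "D = (norm (x - y))\<^sup>2 + e"
      have D: "D > 0" using e by (auto simp: D_def intro: add_nonneg_pos)
      let ?z = "x - y"
      \<comment> \<open>The two unit vectors contribute \<open>- 2 / D\<close> together. As
        \<open>D\<close> exceeds \<open>|z|^2\<close> by \<open>e > 0\<close>, the regularisation
        only lowers the sum, so \<open>perp\<close> bounds it by \<open>- 2 q^2\<close>.\<close>
      have "(2 * (?z \<bullet> a)\<^sup>2 / D\<^sup>2 - (norm a)\<^sup>2 / D) + (2 * (?z \<bullet> b)\<^sup>2 / D\<^sup>2 - (norm b)\<^sup>2 / D)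
        = 2 * ((?z \<bullet> a)\<^sup>2 + (?z \<bullet> b)\<^sup>2 - D) / D\<^sup>2"
        using D ab by (simp add: field_simps power2_eq_square)
      also have "\<dots> \<le> 2 * (- (?z \<bullet> w)\<^sup>2) / D\<^sup>2"
        using perp[of ?z] e by (intro divide_right_mono mult_left_mono) (auto simp: D_def)
      also have "\<dots> = - 2 * (q y)\<^sup>2"
        by (simp add: q_def D_def power_divide)
      finally have "((2 * (?z \<bullet> a)\<^sup>2 / D\<^sup>2 - (norm a)\<^sup>2 / D) + (2 * (?z \<bullet> b)\<^sup>2 / D\<^sup>2 - (norm b)\<^sup>2 / D)) * h y
          \<le> - 2 * (q y)\<^sup>2 * h y"
        using h(2) by (rule mult_right_mono)
      then show "(2 * (?z \<bullet> a)\<^sup>2 / ((norm ?z)\<^sup>2 + e)\<^sup>2 - (norm a)\<^sup>2 / ((norm ?z)\<^sup>2 + e)) * h y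
        + (2 * (?z \<bullet> b)\<^sup>2 / ((norm ?z)\<^sup>2 + e)\<^sup>2 - (norm b)\<^sup>2 / ((norm ?z)\<^sup>2 + e)) * h y
        \<le> - 2 * ((q y)\<^sup>2 * h y)"
        by (simp add: D_def algebra_simps)
    qed (use h e q2h in \<open>auto intro!: Bochner_Integration.integrable_add integrable_reg_hess_kernel\<close>)
  qed (use h e in \<open>auto intro!: integrable_reg_hess_kernel\<close>)
  also have "\<dots> = - 2 * (\<integral>y. (q y)\<^sup>2 * h y \<partial>lborel)" by simp
  finally have "reg_hess h e x a + reg_hess h e x b \<le> - 2 * (\<integral>y. (q y)\<^sup>2 * h y \<partial>lborel)" .
  moreover have "2 * (\<integral>y. (q y)\<^sup>2 * h y \<partial>lborel) \<ge> c * j\<^sup>2"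
  proof -
    define l where "l = c / 2 * j"
    have "0 \<le> (\<integral>y. (q y - l)\<^sup>2 * h y \<partial>lborel)"
      using h(2) by (intro integral_nonneg_AE) auto
    also have "\<dots> = (\<integral>y. (q y)\<^sup>2 * h y - 2 * l * (q y * h y) + l\<^sup>2 * h y \<partial>lborel)"
      by (simp add: power2_diff algebra_simps)
    also have "\<dots> = (\<integral>y. (q y)\<^sup>2 * h y \<partial>lborel) - 2 * l * j + l\<^sup>2 * m"
      using q2h qh h(1) by (simp add: j_def m_def)
    finally have "2 * (\<integral>y. (q y)\<^sup>2 * h y \<partial>lborel) \<ge> 4 * l * j - 2 * l\<^sup>2 * m" by simp
    \<comment> \<open>The value \<open>l = c j / 2\<close> leaves \<open>2 c j^2\<close> minus
      \<open>c m\<close> times \<open>c j^2 / 2\<close>. The mass bound \<open>c m \<le> 2\<close>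
      makes this at least \<open>c j^2\<close>.\<close>
    moreover have "4 * l * j - 2 * l\<^sup>2 * m = 2 * c * j\<^sup>2 - (c * m) * (c * j\<^sup>2 / 2)"
      by (simp add: l_def power2_eq_square)
    moreover have "(c * m) * (c * j\<^sup>2 / 2) \<le> 2 * (c * j\<^sup>2 / 2)"
      using c by (intro mult_right_mono) (auto simp: m_def)
    ultimately show ?thesis by simp
  qed
  moreover have "j = reg_grad h e x w"
    by (simp add: reg_grad_def j_def q_def)
  ultimately show ?thesis by simp
qed

subsection \<open>Logarithmic potentials\<close>

text \<open>Dyadic decomposition: \<open>1 / r\<close> is at most \<open>2^(k+1)\<close> for
  \<open>r\<close> between \<open>2^-(k+1)\<close> and \<open>2^-k\<close>, and the ball of radius
  \<open>2^-k\<close> has volume \<open>v 2^(-kn)\<close>. For \<open>n \<ge> 2\<close> the products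
  are dominated by the geometric series with terms \<open>2 v 2^-k\<close>. By translation
  invariance the bound does not depend on \<open>w\<close>.\<close>

lemma nn_integral_inverse_norm_cball:
  assumes "CARD('n::finite) \<ge> 2"
  shows "\<exists>K::real. K \<ge> 0 \<and> (\<forall>w::real ^ 'n.
    (\<integral>\<^sup>+x. ennreal (1 / norm (x - w)) * indicator (cball w 1) x \<partial>lborel) \<le> ennreal K)"
proof (intro exI conjI allI)
  define v where "v = unit_ball_vol (real CARD('n))"
  have v: "v \<ge> 0" unfolding v_def by (rule less_imp_le[OF unit_ball_vol_pos]) simp
  have [measurable]: "cball w r \<in> sets borel" for w :: "real ^ 'n" and r by simp
  show "4 * v \<ge> 0" using v by simp
  fix w :: "real ^ 'n"
  let ?f = "\<lambda>k x. ennreal (2 ^ Suc k) * indicator (cball w ((1 / 2) ^ k)) x"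
  have "ennreal (1 / norm (x - w)) * indicator (cball w 1) x \<le> (\<Sum>k. ?f k x)" for x
  \<comment> \<open>Outside the ball the indicator vanishes, and at \<open>x = w\<close> the
    integrand is \<open>1 / 0 = 0\<close>.\<close>
  proof (cases "x \<in> cball w 1 \<and> x \<noteq> w")
    case True
    define r where "r = norm (x - w)"
    have r: "0 < r" "r \<le> 1" using True by (auto simp: r_def dist_norm norm_minus_commute)
    \<comment> \<open>The least \<open>N\<close> is not 0 because \<open>r \<le> 1\<close>; its
      predecessor \<open>k\<close> satisfies \<open>2^-(k+1) < r \<le> 2^-k\<close>.\<close>
    define N where "N = (LEAST n. (1 / 2 :: real) ^ n < r)"
    have "\<exists>n. (1 / 2 :: real) ^ n < r" using r by (intro real_arch_pow_inv) auto
    then have N: "(1 / 2) ^ N < r" unfolding N_def by (rule LeastI_ex)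
    with r have "N \<noteq> 0" by (cases "N = 0") auto
    then obtain k where k: "N = Suc k" using not0_implies_Suc by blast
    have "\<not> (1 / 2) ^ k < r"
      using not_less_Least[of k "\<lambda>n. (1 / 2 :: real) ^ n < r"] k by (simp add: N_def)
    then have xk: "x \<in> cball w ((1 / 2) ^ k)" by (simp add: r_def dist_norm norm_minus_commute)
    have "1 / r \<le> 2 ^ Suc k"
      using N r unfolding k by (simp add: field_simps power_one_over)
    then have "ennreal (1 / norm (x - w)) * indicator (cball w 1) x \<le> ?f k x"
      using True xk by (auto simp: r_def intro: ennreal_leI simp del: power_Suc)
    also have "G k \<le> (\<Sum>k. G k)" for G :: "nat \<Rightarrow> ennreal"
      using sum_le_suminf[OF summableI, of "{k}" G] by simp
    finally show ?thesis .
  qed auto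
  then have "(\<integral>\<^sup>+x. ennreal (1 / norm (x - w)) * indicator (cball w 1) x \<partial>lborel)
      \<le> (\<integral>\<^sup>+x. (\<Sum>k. ?f k x) \<partial>lborel)"
    by (rule nn_integral_mono)
  also have "\<dots> = (\<Sum>k. \<integral>\<^sup>+x. ?f k x \<partial>lborel)"
    by (rule nn_integral_suminf) measurable
  also have "\<dots> = (\<Sum>k. ennreal (2 ^ Suc k * (v * ((1 / 2) ^ k) ^ CARD('n))))"
    by (simp add: nn_integral_cmult_indicator emeasure_cball v_def ennreal_mult del: power_Suc)
  also have "\<dots> \<le> (\<Sum>k. ennreal (2 * v * (1 / 2) ^ k))"
  proof (intro suminf_le summableI ennreal_leI)
    fix k
    have "((1 / 2 :: real) ^ k) ^ CARD('n) \<le> ((1 / 2) ^ k) ^ 2"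
      using assms by (intro power_decreasing) (auto simp: power_le_one)
    then have "2 ^ Suc k * (v * ((1 / 2) ^ k) ^ CARD('n)) \<le> 2 ^ Suc k * (v * ((1 / 2) ^ k) ^ 2)"
      using v by (intro mult_left_mono) auto
    also have "\<dots> = 2 * v * (1 / 2) ^ k"
      by (simp add: power2_eq_square field_simps power_one_over)
    finally show "2 ^ Suc k * (v * ((1 / 2) ^ k) ^ CARD('n)) \<le> 2 * v * (1 / 2) ^ k" .
  qed
  also have "\<dots> = ennreal (4 * v)"
  proof (rule suminf_ennreal_eq)
    have "(\<lambda>k. 2 * v * (1 / 2) ^ k) sums (2 * v * (1 / (1 - 1 / 2)))"
      by (intro sums_mult geometric_sums) simp
    then show "(\<lambda>k. 2 * v * (1 / 2) ^ k) sums (4 * v)" by simp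
  qed (use v in auto)
  finally show "(\<integral>\<^sup>+x. ennreal (1 / norm (x - w)) * indicator (cball w 1) x \<partial>lborel) \<le> ennreal (4 * v)" .
qed

text \<open>The kernel is \<open>ln (s / d)\<close> with \<open>s = sqrt (1 + |y|^2)\<close> and
  \<open>d = |x - y|\<close>, and the triangle inequality compares \<open>s\<close> and
  \<open>d\<close>. For \<open>d \<le> 1\<close> the singularity \<open>- ln d\<close> is weakened
  to \<open>1 / d\<close>, whose integral over unit balls is already bounded.\<close>

lemma log_kernel_bounds:
  assumes "x \<noteq> y"
  shows "- ln (2 + norm x) \<le> log_kernel x y"
    and "log_kernel x y \<le> ln (2 + norm x) + (if norm (x - y) \<le> 1 then 1 / norm (x - y) else 0)"
proof -
  define s where "s = sqrt (1 + (norm y)\<^sup>2)"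
  define d where "d = norm (x - y)"
  have d: "d > 0" using assms by (simp add: d_def)
  have s: "1 \<le> s" "norm y \<le> s" by (auto simp: s_def intro: real_le_rsqrt)
  have s': "s \<le> 1 + norm y"
    unfolding s_def by (rule real_le_lsqrt) (auto simp: power2_sum)
  have eq: "log_kernel x y = ln s - ln d"
    by (simp add: log_kernel_def s_def d_def ln_sqrt add_pos_nonneg)
  have y: "norm y \<le> norm x + d"
    using norm_triangle_ineq4[of x "x - y"] by (simp add: d_def)
  have "d \<le> norm x + norm y" by (simp add: d_def norm_triangle_ineq4)
  also have "\<dots> \<le> norm x * s + 2 * s"
    using s mult_left_mono[OF s(1) norm_ge_zero[of x]] by simp
  also have "\<dots> = (2 + norm x) * s" by (simp add: algebra_simps)
  finally have "ln d \<le> ln ((2 + norm x) * s)"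
    using d by (simp add: ln_mono)
  also have "\<dots> = ln (2 + norm x) + ln s"
    using s by (intro ln_mult_pos add_pos_nonneg) auto
  finally show "- ln (2 + norm x) \<le> log_kernel x y" by (simp add: eq)
  show "log_kernel x y \<le> ln (2 + norm x) + (if norm (x - y) \<le> 1 then 1 / norm (x - y) else 0)"
  proof (cases "d \<le> 1")
    case True
    have "s \<le> 2 + norm x" using s' y True by simp
    then have "ln s \<le> ln (2 + norm x)" using s by (intro ln_mono) auto
    moreover have "- ln d \<le> 1 / d"
      using ln_le_minus_one[of "1 / d"] d by (simp add: ln_div)
    ultimately show ?thesis using True by (simp add: eq d_def)
  next
    case False
    have "1 + norm x \<le> (1 + norm x) * d"
      using False mult_left_mono[of 1 d "1 + norm x"] by simp
    then have "s \<le> (2 + norm x) * d" using s' y by (simp add: algebra_simps)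
    then have "ln s \<le> ln ((2 + norm x) * d)" using s by (intro ln_mono) auto
    also have "\<dots> = ln (2 + norm x) + ln d"
      using d by (intro ln_mult_pos add_pos_nonneg) auto
    finally show ?thesis using False by (simp add: eq d_def)
  qed
qed

section \<open>Integrability and convergence of the potential, first almost everywhere, then
  everywhere\<close>

lemma AE_neq_lborel: "AE y in lborel. y \<noteq> (x :: 'a::euclidean_space)"
  by (rule AE_I[where N = "{x}"]) auto

text \<open>By Tonelli, integrating the local singular part \<open>F x y\<close> over
  \<open>x\<close> first gives at most \<open>K\<close> times the mass of \<open>h\<close>. Its
  integral over \<open>y\<close> is therefore finite for almost every \<open>x\<close>, and the rest
  of the kernel is bounded in \<open>y\<close>.\<close>

lemma AE_integrable_log_kernel:
  fixes h :: "real ^ 'n::finite \<Rightarrow> real"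
  assumes n: "CARD('n) \<ge> 2" and h: "integrable lborel h" "\<And>y. h y \<ge> 0"
  shows "AE x in lborel. integrable lborel (\<lambda>y. log_kernel x y * h y)"
proof -
  have [measurable]: "h \<in> borel_measurable borel" using h by auto
  obtain K where K: "K \<ge> 0" "\<And>w::real ^ 'n.
      (\<integral>\<^sup>+x. ennreal (1 / norm (x - w)) * indicator (cball w 1) x \<partial>lborel) \<le> ennreal K"
    using nn_integral_inverse_norm_cball[OF n] by blast
  define F where "F x y = (if norm (x - y) \<le> 1 then 1 / norm (x - y) else 0) * h y" for x y
  have F0: "F x y \<ge> 0" for x y using h by (simp add: F_def)
  have [measurable]: "F x \<in> borel_measurable borel" for x
    unfolding F_def by measurable
  have [measurable]: "cball w r \<in> sets borel" for w :: "real ^ 'n" and r by simp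
  have Fm [measurable]: "(\<lambda>(x, y). ennreal (F x y)) \<in> borel_measurable (lborel \<Otimes>\<^sub>M lborel)"
    unfolding F_def by measurable
  have "(\<integral>\<^sup>+x. \<integral>\<^sup>+y. F x y \<partial>lborel \<partial>lborel) = (\<integral>\<^sup>+y. \<integral>\<^sup>+x. F x y \<partial>lborel \<partial>lborel)"
    by (rule lborel_pair.Fubini'[OF Fm, symmetric])
  also have "\<dots> \<le> (\<integral>\<^sup>+y. ennreal K * ennreal (h y) \<partial>lborel)"
  proof (rule nn_integral_mono)
    fix y
    have "(\<integral>\<^sup>+x. F x y \<partial>lborel)
        = (\<integral>\<^sup>+x. ennreal (h y) * (ennreal (1 / norm (x - y)) * indicator (cball y 1) x) \<partial>lborel)"
      using h(2)[of y] by (intro nn_integral_cong)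
        (auto simp: F_def dist_norm norm_minus_commute ennreal_mult mult.commute simp flip: ennreal_mult split: split_indicator)
    also have "\<dots> = ennreal (h y) * (\<integral>\<^sup>+x. ennreal (1 / norm (x - y)) * indicator (cball y 1) x \<partial>lborel)"
      by (rule nn_integral_cmult) measurable
    also have "\<dots> \<le> ennreal (h y) * ennreal K"
      using K(2) by (intro mult_left_mono) auto
    finally show "(\<integral>\<^sup>+x. F x y \<partial>lborel) \<le> ennreal K * ennreal (h y)" by (simp add: mult.commute)
  qed
  also have "\<dots> = ennreal K * (\<integral>\<^sup>+y. h y \<partial>lborel)"
    by (rule nn_integral_cmult) simp
  also have "\<dots> < \<infinity>"
    using h by (simp add: nn_integral_eq_integral ennreal_mult_less_top)
  finally have fin: "(\<integral>\<^sup>+x. \<integral>\<^sup>+y. F x y \<partial>lborel \<partial>lborel) < \<infinity>" .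
  have "(\<lambda>x. \<integral>\<^sup>+y. F x y \<partial>lborel) \<in> borel_measurable lborel"
    by (rule lborel.borel_measurable_nn_integral[OF Fm])
  then have "AE x in lborel. (\<integral>\<^sup>+y. F x y \<partial>lborel) \<noteq> \<infinity>"
    by (rule nn_integral_PInf_AE) (use fin in simp)
  then show ?thesis
  proof eventually_elim
    fix x assume "(\<integral>\<^sup>+y. F x y \<partial>lborel) \<noteq> \<infinity>"
    then have F: "integrable lborel (F x)"
      using F0 by (intro integrableI_nonneg) (auto simp: less_top)
    show "integrable lborel (\<lambda>y. log_kernel x y * h y)"
    proof (rule Bochner_Integration.integrable_bound[where f = "\<lambda>y. ln (2 + norm x) * h y + F x y"])
      show "AE y in lborel. norm (log_kernel x y * h y) \<le> norm (ln (2 + norm x) * h y + F x y)"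
        using AE_neq_lborel[of x]
      proof eventually_elim
        fix y assume "y \<noteq> x"
        define c where "c = (if norm (x - y) \<le> 1 then 1 / norm (x - y) else 0)"
        have "c \<ge> 0" by (simp add: c_def)
        then have "\<bar>log_kernel x y\<bar> \<le> ln (2 + norm x) + c"
          using log_kernel_bounds[of x y] \<open>y \<noteq> x\<close> unfolding c_def by (auto simp: abs_le_iff)
        then have "\<bar>log_kernel x y\<bar> * h y \<le> (ln (2 + norm x) + c) * h y"
          using h(2) by (rule mult_right_mono)
        also have "\<dots> = ln (2 + norm x) * h y + F x y"
          by (simp add: F_def c_def distrib_right)
        finally show "norm (log_kernel x y * h y) \<le> norm (ln (2 + norm x) * h y + F x y)"
          using h(2)[of y] by (simp add: abs_mult)
      qed
    qed (use h F in auto)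
  qed
qed

text \<open>A strict violation at one point persists on a ball, which has positive measure.\<close>

lemma AE_imp_le_continuous:
  fixes f g :: "'a::euclidean_space \<Rightarrow> real"
  assumes f: "continuous_on UNIV f" and g: "continuous_on UNIV g"
    and ae: "AE x in lborel. f x \<le> g x"
  shows "f x \<le> g x"
proof (rule ccontr)
  assume x: "\<not> f x \<le> g x"
  have "open {x. g x < f x}" using f g by (intro open_Collect_less) auto
  then obtain r where r: "r > 0" "ball x r \<subseteq> {x. g x < f x}"
    using x by (metis mem_Collect_eq not_le openE)
  have "AE y in lborel. y \<notin> ball x r"
    using ae by eventually_elim (use r in force)
  then have "emeasure lborel (ball x r) = 0"
    by (subst (asm) AE_iff_null_sets[symmetric]) auto
  moreover have "unit_ball_vol (real DIM('a)) \<noteq> 0"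
    using unit_ball_vol_pos[of "real DIM('a)"] by (metis less_irrefl of_nat_0_le_iff)
  ultimately show False using r by (simp add: emeasure_ball)
qed

lemma reg_kernel_mono:
  assumes "0 < e'" "e' \<le> e"
  shows "reg_kernel e x y \<le> reg_kernel e' x y"
  using assms unfolding reg_kernel_def by (auto intro!: ln_mono add_nonneg_pos)

lemma reg_kernel_le_log_kernel:
  assumes "0 < e" "x \<noteq> y"
  shows "reg_kernel e x y \<le> log_kernel x y"
proof -
  have "2 * ln (norm (x - y)) = ln ((norm (x - y))\<^sup>2)"
    using assms by (simp add: ln_realpow)
  also have "\<dots> \<le> ln ((norm (x - y))\<^sup>2 + e)"
    using assms by (intro ln_mono) auto
  finally show ?thesis by (simp add: reg_kernel_def log_kernel_def)
qed

text \<open>Almost everywhere \<open>f\<close> dominates the continuous regularised potentials, hence everywhere;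
  so they stay bounded at every point and monotone convergence applies there.\<close>
lemma log_potential_everywhere:
  fixes h :: "real ^ 'n::finite \<Rightarrow> real"
  assumes n: "CARD('n) \<ge> 2" and h: "integrable lborel h" "\<And>y. h y \<ge> 0"
    and f: "continuous_on UNIV f"
    and pot: "\<And>x. integrable lborel (\<lambda>y. log_kernel x y * h y) \<Longrightarrow>
      f x = A + (\<integral>y. log_kernel x y * h y \<partial>lborel)"
  defines "V \<equiv> \<lambda>k x. A + reg_potential h (1 / real (Suc k)) x"
  shows "integrable lborel (\<lambda>y. log_kernel x y * h y)"
    and "incseq (\<lambda>k. V k x)" and "(\<lambda>k. V k x) \<longlonglongrightarrow> f x"
proof -
  have [measurable]: "h \<in> borel_measurable borel" using h by auto
  have e: "0 < 1 / real (Suc k)" for k by simp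
  note I = integrable_reg_kernel[OF h(1) e]
  have contV: "continuous_on UNIV (V k)" for k
    using reg_potential_lipschitz[OF h(1) e[of k]] unfolding V_def
    by (auto intro!: continuous_intros dest: lipschitz_on_continuous_on)
  have kmono: "reg_kernel (1 / real (Suc k)) x y * h y \<le> reg_kernel (1 / real (Suc m)) x y * h y"
    if "k \<le> m" for k m x y
    using that h(2) by (intro mult_right_mono reg_kernel_mono) (auto intro: divide_left_mono)
  show inc: "incseq (\<lambda>k. V k x)" for x
    unfolding V_def reg_potential_def
    by (intro incseq_SucI add_left_mono integral_mono I kmono) auto
  have le: "V k x \<le> f x" for k x
  proof (rule AE_imp_le_continuous[OF contV f])
    show "AE x in lborel. V k x \<le> f x"
      using AE_integrable_log_kernel[OF n h]
    proof eventually_elim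
      fix x assume good: "integrable lborel (\<lambda>y. log_kernel x y * h y)"
      have "reg_potential h (1 / real (Suc k)) x \<le> (\<integral>y. log_kernel x y * h y \<partial>lborel)"
        unfolding reg_potential_def
      proof (rule integral_mono_AE[OF I good])
        show "AE y in lborel. reg_kernel (1 / real (Suc k)) x y * h y \<le> log_kernel x y * h y"
          using AE_neq_lborel[of x]
          by eventually_elim (auto intro!: mult_right_mono reg_kernel_le_log_kernel h(2))
      qed
      then show "V k x \<le> f x" by (simp add: V_def pot[OF good])
    qed
  qed
  obtain l where l: "(\<lambda>k. V k x) \<longlonglongrightarrow> l"
    using incseq_convergent[OF inc] le by metis
  have lim: "(\<lambda>k. reg_potential h (1 / real (Suc k)) x) \<longlonglongrightarrow> l - A"
    using tendsto_diff[OF l tendsto_const[of A]] by (simp add: V_def)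
  have mono: "AE y in lborel. mono (\<lambda>k. reg_kernel (1 / real (Suc k)) x y * h y)"
    using kmono by (auto simp: mono_def)
  have conv: "AE y in lborel. (\<lambda>k. reg_kernel (1 / real (Suc k)) x y * h y) \<longlonglongrightarrow> log_kernel x y * h y"
    using AE_neq_lborel[of x]
  proof eventually_elim
    fix y assume "y \<noteq> x"
    then have pos: "(norm (x - y))\<^sup>2 \<noteq> 0" by simp
    have "(\<lambda>k. reg_kernel (1 / real (Suc k)) x y) \<longlonglongrightarrow>
        ln (1 + (norm y)\<^sup>2) / 2 - ln ((norm (x - y))\<^sup>2 + 0) / 2"
      unfolding reg_kernel_def
      using pos by (intro tendsto_intros LIMSEQ_Suc[OF lim_1_over_n]) auto
    also have "ln ((norm (x - y))\<^sup>2 + 0) / 2 = ln (norm (x - y))"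
      using \<open>y \<noteq> x\<close> by (simp add: ln_realpow)
    finally show "(\<lambda>k. reg_kernel (1 / real (Suc k)) x y * h y) \<longlonglongrightarrow> log_kernel x y * h y"
      unfolding log_kernel_def by (intro tendsto_mult tendsto_const)
  qed
  have meas: "(\<lambda>y. log_kernel x y * h y) \<in> borel_measurable lborel" by simp
  note MC = I mono conv lim[unfolded reg_potential_def] meas
  \<comment> \<open>Monotone convergence with the finite limit \<open>l - A\<close> yields
    integrability at this particular \<open>x\<close>. Only then is \<open>pot\<close> available
    there to identify \<open>l\<close> with \<open>f x\<close>.\<close>
  show good: "integrable lborel (\<lambda>y. log_kernel x y * h y)"
    by (rule integrable_monotone_convergence[OF MC])
  have "(\<integral>y. log_kernel x y * h y \<partial>lborel) = l - A"
    by (rule integral_monotone_convergence[OF MC])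
  with pot[OF good] l show "(\<lambda>k. V k x) \<longlonglongrightarrow> f x" by simp
qed

text \<open>The integral over \<open>y\<close> is \<open>0\<close> when the integrand is not integrable. This happens for all
  \<open>x \<noteq> 0\<close> at once if the singularity of \<open>ln |y|\<close> at the origin is not integrable, and then
  \<open>f\<close> is constant.\<close>
lemma normal_potential_cases:
  fixes h :: "real ^ 'n::finite \<Rightarrow> real"
  assumes h: "integrable lborel h" "\<And>y. h y \<ge> 0"
    and f: "\<And>x. f x = (\<integral>y. ln (norm y / norm (x - y)) * h y \<partial>lborel) + C"
  obtains "\<And>x. f x = C"
  | A where "\<And>x. integrable lborel (\<lambda>y. log_kernel x y * h y) \<Longrightarrow>
      f x = A + (\<integral>y. log_kernel x y * h y \<partial>lborel)"
proof (cases "\<exists>x. x \<noteq> 0 \<and> integrable lborel (\<lambda>y. ln (norm y / norm (x - y)) * h y)")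
  case False
  have "f x = C" for x
  proof (cases "x = 0")
    case True
    \<comment> \<open>At \<open>x = 0\<close> the quotient is 1 for \<open>y\<close> nonzero; at
      \<open>y = 0\<close> it is \<open>0 / 0 = 0\<close>, and \<open>ln 0 = 0\<close>.\<close>
    have "ln (norm y / norm (x - y)) * h y = 0" for y
      using True by (cases "y = 0") auto
    then have "(\<integral>y. ln (norm y / norm (x - y)) * h y \<partial>lborel) = 0" by (simp only:) simp
    then show ?thesis using f[of x] by simp
  next
    case xnz: False
    with False have "\<not> integrable lborel (\<lambda>y. ln (norm y / norm (x - y)) * h y)" by blast
    from not_integrable_integral_eq[OF this] show ?thesis using f[of x] by linarith
  qed
  then show ?thesis using that(1) by blast
next
  case True
  have [measurable]: "h \<in> borel_measurable borel" using h by auto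
  obtain x where x: "x \<noteq> 0" and int: "integrable lborel (\<lambda>y. ln (norm y / norm (x - y)) * h y)"
    using True by blast
  \<comment> \<open>For \<open>|y| < r\<close> one has \<open>|x - y| \<ge> r\<close>, so the
    integrable kernel at \<open>x\<close> controls \<open>ln |y|\<close>. For
    \<open>|y| \<ge> r\<close> the function \<open>k0\<close> below is bounded by \<open>c\<close>,
    its absolute value on the sphere of radius \<open>r\<close>.\<close>
  define r where "r = norm x / 2"
  have r: "r > 0" using x by (simp add: r_def)
  define c where "c = ln (1 + r\<^sup>2) / 2 - ln r"
  \<comment> \<open>\<open>k0\<close> is the difference between \<open>ln (|y| / |x - y|)\<close>
    and \<open>log_kernel x y\<close>, which does not depend on \<open>x\<close>; its integral
    against \<open>h\<close> goes into the constant \<open>A\<close>.\<close>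
  define k0 where "k0 y = ln (norm y) - ln (1 + (norm y)\<^sup>2) / 2" for y :: "real ^ 'n"
  have [measurable]: "k0 \<in> borel_measurable borel" unfolding k0_def by simp
  have c0: "c \<ge> 0"
  proof -
    have "2 * ln r = ln (r\<^sup>2)" using r by (simp add: ln_realpow)
    also have "\<dots> \<le> ln (1 + r\<^sup>2)" using r by (intro ln_mono) auto
    finally show ?thesis by (simp add: c_def)
  qed
  have k0: "\<bar>k0 y\<bar> \<le> c + \<bar>ln (norm y / norm (x - y))\<bar>" if y: "y \<noteq> 0" "y \<noteq> x" for y
  proof -
    have ny: "2 * ln (norm y) = ln ((norm y)\<^sup>2)" using y by (simp add: ln_realpow)
    also have "\<dots> \<le> ln (1 + (norm y)\<^sup>2)" using y by (intro ln_mono) auto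
    finally have neg: "\<bar>k0 y\<bar> = ln (1 + (norm y)\<^sup>2) / 2 - ln (norm y)"
      by (simp add: k0_def)
    show ?thesis
    proof (cases "norm y < r")
      case True
      have "norm x \<le> norm (x - y) + norm y" using norm_triangle_ineq[of "x - y" y] by simp
      then have "r \<le> norm (x - y)" using True by (simp add: r_def)
      then have "ln r \<le> ln (norm (x - y))" using r by (intro ln_mono) auto
      moreover have "ln (norm y / norm (x - y)) = ln (norm y) - ln (norm (x - y))"
        using y by (intro ln_divide_pos) auto
      moreover have "ln (1 + (norm y)\<^sup>2) \<le> ln (1 + r\<^sup>2)"
        using True r by (intro ln_mono add_left_mono power_mono) (auto intro: add_pos_nonneg)
      ultimately show ?thesis unfolding neg c_def by linarith
    next
      case False
      define N where "N = (norm y)\<^sup>2"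
      have N: "N > 0" "r\<^sup>2 \<le> N" using y False r by (auto simp: N_def intro: power_mono)
      have r2: "r\<^sup>2 > 0" using r by simp
      have "(1 + N) * r\<^sup>2 \<le> (1 + r\<^sup>2) * N"
        using N by (simp add: algebra_simps)
      then have "ln ((1 + N) * r\<^sup>2) \<le> ln ((1 + r\<^sup>2) * N)"
        using N r2 by (intro ln_mono mult_pos_pos add_pos_pos) (simp_all only: N zero_less_one)
      moreover have "ln ((1 + N) * r\<^sup>2) = ln (1 + N) + ln (r\<^sup>2)"
        using N r2 by (intro ln_mult_pos add_pos_pos) (simp_all only: N zero_less_one)
      moreover have "ln ((1 + r\<^sup>2) * N) = ln (1 + r\<^sup>2) + ln N"
        using N r2 by (intro ln_mult_pos add_pos_pos) (simp_all only: N zero_less_one)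
      moreover have "ln (r\<^sup>2) = 2 * ln r" using r by (simp add: ln_realpow)
      ultimately have "\<bar>k0 y\<bar> \<le> c"
        using ny unfolding neg c_def N_def[symmetric] by linarith
      then show ?thesis by linarith
    qed
  qed
  have k0h: "integrable lborel (\<lambda>y. k0 y * h y)"
  proof (rule Bochner_Integration.integrable_bound
      [where f = "\<lambda>y. c * h y + \<bar>ln (norm y / norm (x - y)) * h y\<bar>"])
    show "AE y in lborel. norm (k0 y * h y) \<le> norm (c * h y + \<bar>ln (norm y / norm (x - y)) * h y\<bar>)"
      using AE_neq_lborel[of x] AE_neq_lborel[of 0]
    proof eventually_elim
      fix y assume y: "y \<noteq> x" "y \<noteq> 0"
      have "\<bar>k0 y\<bar> * h y \<le> (c + \<bar>ln (norm y / norm (x - y))\<bar>) * h y"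
        using k0[OF y(2,1)] h(2) by (rule mult_right_mono)
      then show "norm (k0 y * h y) \<le> norm (c * h y + \<bar>ln (norm y / norm (x - y)) * h y\<bar>)"
        using h(2)[of y] c0 by (simp add: abs_mult distrib_right)
    qed
  qed (use h int in \<open>auto intro!: Bochner_Integration.integrable_add\<close>)
  show ?thesis
  proof (rule that(2)[where A = "C + (\<integral>y. k0 y * h y \<partial>lborel)"])
    fix x assume good: "integrable lborel (\<lambda>y. log_kernel x y * h y)"
    have "(\<integral>y. ln (norm y / norm (x - y)) * h y \<partial>lborel)
        = (\<integral>y. k0 y * h y + log_kernel x y * h y \<partial>lborel)"
    proof (rule integral_cong_AE)
      show "AE y in lborel. ln (norm y / norm (x - y)) * h y = k0 y * h y + log_kernel x y * h y"
        using AE_neq_lborel[of x] AE_neq_lborel[of 0]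
        by eventually_elim (auto simp: k0_def log_kernel_def ln_div algebra_simps)
    qed auto
    also have "\<dots> = (\<integral>y. k0 y * h y \<partial>lborel) + (\<integral>y. log_kernel x y * h y \<partial>lborel)"
      by (rule Bochner_Integration.integral_add[OF k0h good])
    finally show "f x = C + (\<integral>y. k0 y * h y \<partial>lborel) + (\<integral>y. log_kernel x y * h y \<partial>lborel)"
      by (simp add: f[of x])
  qed
qed

subsection \<open>Rays of finite length\<close>

text \<open>A form of Jensen's inequality for a subprobability density \<open>h\<close>: integrate the tangent line
  bound \<open>exp \<psi> \<ge> exp P * (1 + \<psi> - P)\<close> at \<open>P = \<integral>\<psi> h\<close>.\<close>
lemma exp_integral_le:
  fixes \<psi> h :: "'a \<Rightarrow> real"
  assumes h: "integrable M h" "\<And>y. h y \<ge> 0" "(\<integral>y. h y \<partial>M) \<le> 1"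
    and \<psi>: "integrable M (\<lambda>y. \<psi> y * h y)" "\<And>y. \<psi> y \<ge> 0"
    and e: "integrable M (\<lambda>y. exp (\<psi> y) * h y)"
  shows "exp (\<integral>y. \<psi> y * h y \<partial>M) \<le> 1 + (\<integral>y. exp (\<psi> y) * h y \<partial>M)"
proof -
  define P m where "P = (\<integral>y. \<psi> y * h y \<partial>M)" and "m = (\<integral>y. h y \<partial>M)"
  have m: "0 \<le> m" "m \<le> 1" using h by (auto simp: m_def)
  have "exp P * (m + P - P * m) = (\<integral>y. exp P * ((1 - P) * h y + \<psi> y * h y) \<partial>M)"
  proof -
    have "(\<integral>y. (1 - P) * h y + \<psi> y * h y \<partial>M) = (1 - P) * m + P"
      unfolding m_def by (simp add: h(1) \<psi>(1) P_def[symmetric])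
    then have "(\<integral>y. exp P * ((1 - P) * h y + \<psi> y * h y) \<partial>M) = exp P * ((1 - P) * m + P)" by simp
    then show ?thesis by (simp only:) (simp add: algebra_simps)
  qed
  also have "\<dots> \<le> (\<integral>y. exp (\<psi> y) * h y \<partial>M)"
  proof (rule integral_mono)
    fix y
    have "1 + (\<psi> y - P) \<le> exp (\<psi> y - P)" by (rule exp_ge_add_one_self)
    then have "exp P * (1 + (\<psi> y - P)) \<le> exp P * exp (\<psi> y - P)" by simp
    also have "\<dots> = exp (\<psi> y)" by (simp flip: exp_add)
    finally have "exp P * (1 + (\<psi> y - P)) * h y \<le> exp (\<psi> y) * h y"
      using h(2) by (rule mult_right_mono)
    then show "exp P * ((1 - P) * h y + \<psi> y * h y) \<le> exp (\<psi> y) * h y"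
      by (simp add: algebra_simps)
  qed (use h \<psi> e in auto)
  finally have 1: "exp P * (m + P - P * m) \<le> (\<integral>y. exp (\<psi> y) * h y \<partial>M)" .
  \<comment> \<open>This accounts for the mass \<open>1 - m\<close> missing from a probability
    density: \<open>exp P\<close> is \<open>exp P * (1 - P)\<close> weighted by
    \<open>1 - m\<close>, plus the term estimated in \<open>1\<close>. It produces the summand 1 of
    the conclusion.\<close>
  have "exp P * (1 - P) \<le> 1"
  proof -
    have "1 - P \<le> exp (- P)" using exp_ge_add_one_self[of "- P"] by simp
    then have "exp P * (1 - P) \<le> exp P * exp (- P)" by simp
    then show ?thesis by (simp flip: exp_add)
  qed
  then have "(1 - m) * (exp P * (1 - P)) \<le> 1"
    using m mult_left_mono[of "exp P * (1 - P)" 1 "1 - m"] by simp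
  note 2 = add_mono[OF this 1]
  have "exp P = (1 - m) * (exp P * (1 - P)) + exp P * (m + P - P * m)"
    by (simp add: algebra_simps)
  also note 2
  finally show ?thesis unfolding P_def .
qed

lemma integral_cball_tendsto:
  fixes h :: "'a::euclidean_space \<Rightarrow> real"
  assumes h: "integrable lborel h"
  shows "(\<lambda>k. \<integral>y. indicator (cball 0 (real k)) y * h y \<partial>lborel) \<longlonglongrightarrow> (\<integral>y. h y \<partial>lborel)"
proof (rule integral_dominated_convergence[where w = "\<lambda>y. \<bar>h y\<bar>"])
  have [measurable]: "h \<in> borel_measurable borel" using h by auto
  have [measurable]: "cball (0::'a) r \<in> sets borel" for r by simp
  show "(\<lambda>y. indicator (cball 0 (real k)) y * h y) \<in> borel_measurable lborel" for k by measurable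
  show "AE y in lborel. (\<lambda>k. indicator (cball 0 (real k)) y * h y) \<longlonglongrightarrow> h y"
  proof (rule AE_I2, rule tendsto_eventually)
    fix y :: 'a
    obtain N where "norm y \<le> real N" using real_arch_simple by blast
    then show "\<forall>\<^sub>F k in sequentially. indicator (cball 0 (real k)) y * h y = h y"
      by (intro eventually_sequentiallyI[of N]) (auto split: split_indicator)
  qed
qed (use h in \<open>auto split: split_indicator\<close>)

text \<open>The part \<open>h1\<close> of \<open>h\<close> in a large ball has mass above 2 and
  yields the decay \<open>t^-2\<close>. The remainder \<open>h2\<close> has mass at most 1, so its
  exponentiated potential is bounded by an integral through the Jensen-type inequality.\<close>

lemma log_potential_ray_bound:
  fixes h :: "real ^ 'n::finite \<Rightarrow> real"
  assumes h: "integrable lborel h" "\<And>y. h y \<ge> 0"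
    and pot: "\<And>x. integrable lborel (\<lambda>y. log_kernel x y * h y)"
      "\<And>x. f x = A + (\<integral>y. log_kernel x y * h y \<partial>lborel)"
    and m: "(\<integral>y. h y \<partial>lborel) > 2"
  obtains E T :: real where "E \<ge> 0" "T \<ge> 1"
    "\<And>t v. t \<ge> T \<Longrightarrow> 1 \<le> norm v \<Longrightarrow> norm v \<le> 3 \<Longrightarrow>
      ennreal (exp (f (t *\<^sub>R v))) \<le> ennreal (E / t\<^sup>2) *
        (1 + (\<integral>\<^sup>+y. ennreal ((2 + 4 / norm (v - y /\<^sub>R t)) * h y) \<partial>lborel))"
proof -
  have [measurable]: "h \<in> borel_measurable borel" using h by auto
  let ?m = "\<integral>y. h y \<partial>lborel"
  \<comment> \<open>Exceeding 2 gives the decay of the near part; exceeding \<open>?m - 1\<close>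
    leaves mass below 1 outside.\<close>
  have "\<forall>\<^sub>F k in sequentially. max 2 (?m - 1) < (\<integral>y. indicator (cball 0 (real k)) y * h y \<partial>lborel)"
    using m by (intro order_tendstoD(1)[OF integral_cball_tendsto[OF h(1)]]) auto
  then obtain k where k: "max 2 (?m - 1) < (\<integral>y. indicator (cball 0 (real k)) y * h y \<partial>lborel)"
    by (auto simp: eventually_sequentially)
  define R where "R = real k"
  have R: "R \<ge> 0" by (simp add: R_def)
  define B where "B = cball (0 :: real ^ 'n) R"
  have [measurable]: "B \<in> sets borel" by (simp add: B_def)
  define h1 h2 where "h1 y = indicator B y * h y" and "h2 y = indicator (- B) y * h y" for y
  have h12: "h1 y + h2 y = h y" "0 \<le> h1 y" "0 \<le> h2 y" for y
    using h(2)[of y] by (auto simp: h1_def h2_def split: split_indicator)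
  have split: "integrable lborel (\<lambda>y. g y * h1 y)" "integrable lborel (\<lambda>y. g y * h2 y)"
    if "integrable lborel (\<lambda>y. g y * h y)" for g :: "real ^ 'n \<Rightarrow> real"
  proof -
    have "integrable lborel (\<lambda>y. indicator B y *\<^sub>R (g y * h y))"
      by (rule integrable_mult_indicator) (use that in auto)
    then show "integrable lborel (\<lambda>y. g y * h1 y)" by (simp add: h1_def mult_ac)
    have "integrable lborel (\<lambda>y. indicator (- B) y *\<^sub>R (g y * h y))"
      by (rule integrable_mult_indicator) (use that in auto)
    then show "integrable lborel (\<lambda>y. g y * h2 y)" by (simp add: h2_def mult_ac)
  qed
  have hint: "integrable lborel h1" "integrable lborel h2"
    using split[of "\<lambda>_. 1"] h(1) by auto
  define m1 m2 where "m1 = (\<integral>y. h1 y \<partial>lborel)" and "m2 = (\<integral>y. h2 y \<partial>lborel)"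
  have "?m = m1 + m2"
    unfolding m1_def m2_def by (subst Bochner_Integration.integral_add[symmetric]) (auto simp: hint h12)
  moreover have "m1 > max 2 (?m - 1)"
    using k by (simp add: m1_def h1_def B_def R_def)
  ultimately have m1: "m1 > 2" and m2: "m2 \<le> 1" by auto
  define c where "c = ln (1 + R\<^sup>2) / 2 + ln 2"
  define E where "E = exp (A + m1 * c)"
  show ?thesis
  \<comment> \<open>For \<open>t\<close> at least \<open>2 * R + 2\<close> and
    \<open>|y| \<le> R\<close>, the distance from \<open>x = t v\<close> to \<open>y\<close> is at
    least \<open>t - R \<ge> t / 2\<close>. Also \<open>ln t \<ge> 0\<close>.\<close>
  proof (rule that[of E "2 * R + 2"])
    show "E \<ge> 0" "2 * R + 2 \<ge> 1" using R by (auto simp: E_def)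
    fix t :: real and v :: "real ^ 'n"
    assume t: "t \<ge> 2 * R + 2" and v: "1 \<le> norm v" "norm v \<le> 3"
    define x where "x = t *\<^sub>R v"
    have t1: "t \<ge> 1" "t > 0" using t R by auto
    have nx: "t \<le> norm x" "norm x \<le> 3 * t"
      using v t1 mult_left_mono[of 1 "norm v" t] by (auto simp: x_def)
    \<comment> \<open>With \<open>d = |x - y|\<close> this is \<open>(2 d + 4 t) / d\<close>, and
      \<open>sqrt (1 + |y|^2) \<le> 1 + |x| + d \<le> 2 d + 4 t\<close>. At \<open>y = x\<close> the
      fraction is \<open>4 / 0 = 0\<close>, so \<open>q \<ge> 2\<close> holds everywhere and
      \<open>ln q\<close> is non-negative.\<close>
    define q where "q y = 2 + 4 / norm (v - y /\<^sub>R t)" for y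
    have q: "q y \<ge> 2" for y by (simp add: q_def)
    have [measurable]: "q \<in> borel_measurable borel" unfolding q_def by measurable
    define Z where "Z = (\<integral>\<^sup>+y. ennreal (q y * h y) \<partial>lborel)"
    have near: "log_kernel x y \<le> c - ln t" if "y \<in> B" for y
    proof -
      have y: "norm y \<le> R" using that by (simp add: B_def)
      have "norm x \<le> norm (x - y) + norm y" using norm_triangle_ineq[of "x - y" y] by simp
      then have "t / 2 \<le> norm (x - y)" using y nx t R by simp
      then have "ln (t / 2) \<le> ln (norm (x - y))" using t1 by (intro ln_mono) auto
      moreover have "ln (t / 2) = ln t - ln 2" using t1 by (intro ln_divide_pos) auto
      moreover have "ln (1 + (norm y)\<^sup>2) \<le> ln (1 + R\<^sup>2)"
        using y by (intro ln_mono add_left_mono power_mono) (auto intro: add_pos_nonneg)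
      ultimately show ?thesis unfolding log_kernel_def c_def by linarith
    qed
    have far: "log_kernel x y \<le> ln (q y)" if "y \<noteq> x" for y
    proof -
      define s where "s = sqrt (1 + (norm y)\<^sup>2)"
      define d where "d = norm (x - y)"
      have d: "d > 0" using that by (simp add: d_def)
      have s1: "1 \<le> s" by (simp add: s_def)
      have "s \<le> 1 + norm y"
        unfolding s_def by (rule real_le_lsqrt) (auto simp: power2_sum)
      also have "norm y \<le> norm x + d"
        using norm_triangle_ineq4[of x "x - y"] by (simp add: d_def)
      also have "1 + (norm x + d) \<le> 2 * d + 4 * t" using nx t1 d by simp
      finally have "s \<le> 2 * d + 4 * t" by simp
      also have "\<dots> = q y * d"
      proof -
        have "v - y /\<^sub>R t = (x - y) /\<^sub>R t" using t1 by (simp add: x_def scaleR_diff_right)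
        then have "norm (v - y /\<^sub>R t) = d / t" using t1 by (simp add: d_def divide_inverse mult.commute)
        then have "q y = 2 + 4 / (d / t)" by (simp only: q_def)
        then show ?thesis using d t1 by (simp add: field_simps)
      qed
      finally have "ln s \<le> ln (q y * d)" using s1 by (intro ln_mono) auto
      also have "\<dots> = ln (q y) + ln d" using q[of y] d by (intro ln_mult_pos) auto
      finally show ?thesis
        by (simp add: log_kernel_def s_def d_def ln_sqrt add_pos_nonneg)
    qed
    show "ennreal (exp (f (t *\<^sub>R v))) \<le> ennreal (E / t\<^sup>2) *
        (1 + (\<integral>\<^sup>+y. ennreal ((2 + 4 / norm (v - y /\<^sub>R t)) * h y) \<partial>lborel))"
      unfolding x_def[symmetric] q_def[symmetric] Z_def[symmetric]
    \<comment> \<open>If \<open>Z\<close> is infinite so is the right side, since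
      \<open>E / t^2 > 0\<close>; otherwise \<open>q h\<close> is integrable and the Jensen-type
      bound applies.\<close>
    proof (cases "Z = \<infinity>")
      case True
      have "ennreal (E / t\<^sup>2) > 0" using t1 by (simp add: E_def)
      with True show "ennreal (exp (f x)) \<le> ennreal (E / t\<^sup>2) * (1 + Z)"
        by (simp add: ennreal_mult_top del: ennreal_less_zero_iff)
    next
      case False
      then have qh: "integrable lborel (\<lambda>y. q y * h y)"
        using q h(2) unfolding Z_def by (intro integrableI_nonneg) (auto simp: less_top intro!: mult_nonneg_nonneg order_trans[OF _ q])
      have lnq: "0 \<le> ln (q y)" "ln (q y) \<le> q y" for y
        using q[of y] ln_le_minus_one[of "q y"] by (auto intro: ln_ge_zero)
      have lnqh: "integrable lborel (\<lambda>y. ln (q y) * h y)"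
      proof (rule Bochner_Integration.integrable_bound[OF qh])
        show "AE y in lborel. norm (ln (q y) * h y) \<le> norm (q y * h y)"
          using lnq q h(2) by (intro AE_I2) (auto simp: abs_mult intro!: mult_right_mono order_trans[OF _ abs_ge_self])
      qed measurable
      have eln: "exp (ln (q y)) = q y" for y using q[of y] by simp
      have P: "exp (\<integral>y. ln (q y) * h2 y \<partial>lborel) \<le> 1 + (\<integral>y. q y * h2 y \<partial>lborel)"
        using exp_integral_le[OF hint(2) h12(3), of "\<lambda>y. ln (q y)"] m2 lnq(1) split(2)[OF lnqh] split(2)[OF qh]
        unfolding eln m2_def by blast
      have le: "(\<integral>y. q y * h2 y \<partial>lborel) \<le> (\<integral>y. q y * h y \<partial>lborel)"
      proof (rule integral_mono[OF split(2)[OF qh] qh])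
        show "q y * h2 y \<le> q y * h y" for y
          using h12[of y] q[of y] by (intro mult_left_mono) auto
      qed
      have "ennreal (\<integral>y. q y * h y \<partial>lborel) = Z"
        unfolding Z_def using q h(2) qh
        by (intro nn_integral_eq_integral[symmetric]) (auto intro!: mult_nonneg_nonneg order_trans[OF _ q])
      with ennreal_leI[OF le] have Z: "ennreal (\<integral>y. q y * h2 y \<partial>lborel) \<le> Z" by simp
      have "f x = A + (\<integral>y. log_kernel x y * h1 y + log_kernel x y * h2 y \<partial>lborel)"
        by (simp add: pot(2) h12 flip: distrib_left)
      also have "\<dots> = A + (\<integral>y. log_kernel x y * h1 y \<partial>lborel) + (\<integral>y. log_kernel x y * h2 y \<partial>lborel)"
        using split[OF pot(1)[of x]] by simp
      also have "(\<integral>y. log_kernel x y * h1 y \<partial>lborel) \<le> (\<integral>y. (c - ln t) * h1 y \<partial>lborel)"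
      proof (rule integral_mono[OF split(1)[OF pot(1)] integrable_mult_right[OF hint(1)]])
        show "log_kernel x y * h1 y \<le> (c - ln t) * h1 y" for y
          using near[of y] h(2)[of y] by (cases "y \<in> B") (auto simp: h1_def intro: mult_right_mono)
      qed
      also have "\<dots> = (c - ln t) * m1" by (simp add: m1_def)
      \<comment> \<open>Here \<open>m1 > 2\<close> becomes the exponent in \<open>t^-2\<close>,
        using \<open>ln t \<ge> 0\<close>.\<close>
      also have "\<dots> \<le> m1 * c - 2 * ln t"
        using m1 t1 mult_right_mono[of 2 m1 "ln t"] by (simp add: algebra_simps)
      also have "(\<integral>y. log_kernel x y * h2 y \<partial>lborel) \<le> (\<integral>y. ln (q y) * h2 y \<partial>lborel)"
      proof (rule integral_mono_AE[OF split(2)[OF pot(1)] split(2)[OF lnqh]])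
        show "AE y in lborel. log_kernel x y * h2 y \<le> ln (q y) * h2 y"
          using AE_neq_lborel[of x] by eventually_elim (auto intro!: mult_right_mono far h12)
      qed
      finally have "exp (f x) \<le> exp (A + (m1 * c - 2 * ln t) + (\<integral>y. ln (q y) * h2 y \<partial>lborel))" by simp
      also have "\<dots> = E / t\<^sup>2 * exp (\<integral>y. ln (q y) * h2 y \<partial>lborel)"
      proof -
        have "exp (2 * ln t) = t\<^sup>2" using t1 by (simp add: exp_double)
        then show ?thesis
          by (simp add: E_def exp_add exp_diff)
      qed
      also have "\<dots> \<le> E / t\<^sup>2 * (1 + (\<integral>y. q y * h2 y \<partial>lborel))"
        using P by (intro mult_left_mono) (auto simp: E_def)
      finally have "ennreal (exp (f x)) \<le> ennreal (E / t\<^sup>2 * (1 + (\<integral>y. q y * h2 y \<partial>lborel)))"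
        by (rule ennreal_leI)
      also have "\<dots> = ennreal (E / t\<^sup>2) * (1 + ennreal (\<integral>y. q y * h2 y \<partial>lborel))"
      proof -
        have "0 \<le> (\<integral>y. q y * h2 y \<partial>lborel)"
          using q h12 by (intro integral_nonneg_AE AE_I2) (auto intro!: mult_nonneg_nonneg order_trans[OF _ q])
        moreover have "0 \<le> E / t\<^sup>2" by (simp add: E_def)
        ultimately show ?thesis by (subst ennreal_mult) (simp_all only: ennreal_plus ennreal_1 add_nonneg_nonneg zero_le_one)
      qed
      also have "\<dots> \<le> ennreal (E / t\<^sup>2) * (1 + Z)"
        using Z by (intro mult_left_mono add_left_mono) auto
      finally show "ennreal (exp (f x)) \<le> ennreal (E / t\<^sup>2) * (1 + Z)" .
    qed
  qed
qed

lemma nn_integral_inverse_square: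
  assumes "T \<ge> 1"
  shows "(\<integral>\<^sup>+t\<in>{T..}. ennreal (1 / t\<^sup>2) \<partial>lborel) = ennreal (1 / T)"
proof -
  have "(\<integral>\<^sup>+t\<in>{T..}. ennreal (1 / t\<^sup>2) \<partial>lborel) = ennreal (0 - (- inverse T))"
  proof (rule nn_integral_FTC_atLeast)
    show "DERIV (\<lambda>t. - inverse t) t :> 1 / t\<^sup>2" if "T \<le> t" for t
      using that assms by (auto intro!: derivative_eq_intros simp: power2_eq_square field_simps)
    show "((\<lambda>t. - inverse t) \<longlongrightarrow> (0 :: real)) at_top"
      using tendsto_minus[OF tendsto_inverse_0_at_top[OF filterlim_ident]] by simp
  qed auto
  then show ?thesis by (simp add: inverse_eq_divide)
qed

text \<open>Averaging over the directions \<open>v\<close> in a ball of radius 1 around a vector of length 2 controls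
  the contribution of the part of \<open>h\<close> near the ray, which no pointwise bound does.\<close>
lemma log_potential_finite_ray:
  fixes h :: "real ^ 'n::finite \<Rightarrow> real"
  assumes n: "CARD('n) \<ge> 2" and h: "integrable lborel h" "\<And>y. h y \<ge> 0"
    and f: "continuous_on UNIV f"
    and pot: "\<And>x. integrable lborel (\<lambda>y. log_kernel x y * h y)"
      "\<And>x. f x = A + (\<integral>y. log_kernel x y * h y \<partial>lborel)"
    and m: "(\<integral>y. h y \<partial>lborel) > 2"
  obtains v T where "v \<noteq> 0" "(\<integral>\<^sup>+t\<in>{T..}. ennreal (exp (f (t *\<^sub>R v))) \<partial>lborel) < \<infinity>"
proof -
  have [measurable]: "h \<in> borel_measurable borel" using h by auto
  obtain E T :: real where ET: "E \<ge> 0" "T \<ge> 1"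
    "\<And>t v. t \<ge> T \<Longrightarrow> 1 \<le> norm v \<Longrightarrow> norm v \<le> 3 \<Longrightarrow>
      ennreal (exp (f (t *\<^sub>R v))) \<le> ennreal (E / t\<^sup>2) *
        (1 + (\<integral>\<^sup>+y. ennreal ((2 + 4 / norm (v - y /\<^sub>R t)) * h y) \<partial>lborel))"
    using log_potential_ray_bound[OF h pot m] by blast
  obtain K where K: "K \<ge> 0" "\<And>w::real ^ 'n.
      (\<integral>\<^sup>+x. ennreal (1 / norm (x - w)) * indicator (cball w 1) x \<partial>lborel) \<le> ennreal K"
    using nn_integral_inverse_norm_cball[OF n] by blast
  have [measurable]: "f \<in> borel_measurable borel" using f by (rule borel_measurable_continuous_onI)
  \<comment> \<open>Any vector of length 2 would do; the unit ball around it keeps the directions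
    \<open>v\<close> within the range of lengths 1 to 3 required above.\<close>
  define b :: "real ^ 'n" where "b = 2 *\<^sub>R axis undefined 1"
  have nb: "norm b = 2" by (simp add: b_def)
  define D where "D = ball b 1"
  have [measurable]: "D \<in> sets borel" by (simp add: D_def)
  have [measurable]: "cball w r \<in> sets borel" for w :: "real ^ 'n" and r by simp
  have D: "1 \<le> norm v" "norm v \<le> 3" if "v \<in> D" for v
    using that nb norm_triangle_ineq2[of b v] norm_triangle_ineq2[of v b]
    by (auto simp: D_def dist_norm norm_minus_commute)
  define \<mu> where "\<mu> = measure lborel D"
  have \<mu>: "emeasure lborel D = ennreal \<mu>" "\<mu> > 0"
    using unit_ball_vol_pos[of "real DIM(real ^ 'n)"]
    by (auto simp: \<mu>_def D_def measure_def emeasure_ball)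
  let ?q = "\<lambda>t v y. 2 + 4 / norm (v - y /\<^sub>R t)"
  \<comment> \<open>Within distance 1 of \<open>y / t\<close> the singularity integrates to at most
    \<open>4 K\<close>; farther away the function is at most 6. The bound is uniform in
    \<open>t\<close> and \<open>y\<close>.\<close>
  have inner: "(\<integral>\<^sup>+v\<in>D. ennreal (?q t v y) \<partial>lborel) \<le> ennreal (6 * \<mu> + 4 * K)" for t y
  proof -
    let ?w = "y /\<^sub>R t"
    have "(\<integral>\<^sup>+v\<in>D. ennreal (?q t v y) \<partial>lborel)
      \<le> (\<integral>\<^sup>+v. 6 * indicator D v + 4 * (ennreal (1 / norm (v - ?w)) * indicator (cball ?w 1) v) \<partial>lborel)"
    proof (rule nn_integral_mono)
      fix v
      show "ennreal (?q t v y) * indicator D v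
        \<le> 6 * indicator D v + 4 * (ennreal (1 / norm (v - ?w)) * indicator (cball ?w 1) v)"
      proof (cases "v \<in> cball ?w 1")
        case True
        have "ennreal (?q t v y) \<le> ennreal (6 + 4 * (1 / norm (v - ?w)))" by (intro ennreal_leI) simp
        also have "\<dots> = 6 + 4 * ennreal (1 / norm (v - ?w))"
          by (subst ennreal_plus, simp, simp, subst ennreal_mult) auto
        finally show ?thesis using True by (auto split: split_indicator)
      next
        case False
        then have "1 / norm (v - ?w) \<le> 1" by (simp add: dist_norm norm_minus_commute divide_le_eq_1)
        then have "ennreal (?q t v y) \<le> ennreal 6" by (intro ennreal_leI) simp
        then show ?thesis using False by (auto split: split_indicator)
      qed
    qed
    also have "\<dots> = 6 * emeasure lborel D
        + 4 * (\<integral>\<^sup>+v. ennreal (1 / norm (v - ?w)) * indicator (cball ?w 1) v \<partial>lborel)"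
      by (subst nn_integral_add) (auto simp: nn_integral_cmult)
    also have "\<dots> \<le> 6 * ennreal \<mu> + 4 * ennreal K"
      unfolding \<mu>(1) by (intro add_left_mono mult_left_mono K(2)) auto
    also have "\<dots> = ennreal (6 * \<mu> + 4 * K)"
      using \<mu> K by (simp add: ennreal_plus ennreal_mult)
    finally show ?thesis .
  qed
  define Q where "Q = \<mu> + (6 * \<mu> + 4 * K) * (\<integral>y. h y \<partial>lborel)"
  have Q0: "Q \<ge> 0" using \<mu> K m by (simp add: Q_def)
  have avg: "(\<integral>\<^sup>+v\<in>D. (1 + (\<integral>\<^sup>+y. ennreal (?q t v y * h y) \<partial>lborel)) \<partial>lborel) \<le> ennreal Q" for t
  proof -
    have "(\<integral>\<^sup>+v\<in>D. (1 + (\<integral>\<^sup>+y. ennreal (?q t v y * h y) \<partial>lborel)) \<partial>lborel)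
      = (\<integral>\<^sup>+v. (indicator D v + (\<integral>\<^sup>+y. ennreal (?q t v y * h y) * indicator D v \<partial>lborel)) \<partial>lborel)"
      by (intro nn_integral_cong) (auto split: split_indicator)
    also have "\<dots> = emeasure lborel D + (\<integral>\<^sup>+v. (\<integral>\<^sup>+y. ennreal (?q t v y * h y) * indicator D v \<partial>lborel) \<partial>lborel)"
      by (subst nn_integral_add) auto
    also have "(\<integral>\<^sup>+v. (\<integral>\<^sup>+y. ennreal (?q t v y * h y) * indicator D v \<partial>lborel) \<partial>lborel)
        = (\<integral>\<^sup>+y. (\<integral>\<^sup>+v. ennreal (?q t v y * h y) * indicator D v \<partial>lborel) \<partial>lborel)"
      by (rule lborel_pair.Fubini') measurable
    also have "\<dots> = (\<integral>\<^sup>+y. ennreal (h y) * (\<integral>\<^sup>+v\<in>D. ennreal (?q t v y) \<partial>lborel) \<partial>lborel)"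
    proof (rule nn_integral_cong)
      fix y
      have "(\<integral>\<^sup>+v. ennreal (?q t v y * h y) * indicator D v \<partial>lborel)
        = (\<integral>\<^sup>+v. ennreal (h y) * (ennreal (?q t v y) * indicator D v) \<partial>lborel)"
        using h(2)[of y] by (intro nn_integral_cong) (simp add: ennreal_mult mult_ac)
      also have "\<dots> = ennreal (h y) * (\<integral>\<^sup>+v\<in>D. ennreal (?q t v y) \<partial>lborel)"
        by (rule nn_integral_cmult) measurable
      finally show "(\<integral>\<^sup>+v. ennreal (?q t v y * h y) * indicator D v \<partial>lborel)
        = ennreal (h y) * (\<integral>\<^sup>+v\<in>D. ennreal (?q t v y) \<partial>lborel)" .
    qed
    also have "\<dots> \<le> (\<integral>\<^sup>+y. ennreal (h y) * ennreal (6 * \<mu> + 4 * K) \<partial>lborel)"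
      by (intro nn_integral_mono mult_left_mono inner) auto
    also have "\<dots> = ennreal (6 * \<mu> + 4 * K) * ennreal (\<integral>y. h y \<partial>lborel)"
      using h by (simp add: nn_integral_multc nn_integral_eq_integral mult.commute)
    also have "emeasure lborel D + \<dots> = ennreal Q"
      using \<mu> K m by (simp add: Q_def ennreal_plus ennreal_mult)
    finally show ?thesis by (simp add: add_left_mono)
  qed
  let ?F = "\<lambda>v t. ennreal (exp (f (t *\<^sub>R v))) * indicator {T..} t * indicator D v"
  have Fm [measurable]: "(\<lambda>(v, t). ?F v t) \<in> borel_measurable (lborel \<Otimes>\<^sub>M lborel)"
    by measurable
  \<comment> \<open>Tonelli again: for each \<open>t\<close> the integral over directions is at most
    \<open>E Q / t^2\<close>, which is integrable on \<open>{T..}\<close>. Hence almost every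
    direction has a finite ray integral, and \<open>D\<close> has positive measure.\<close>
  have "(\<integral>\<^sup>+v. \<integral>\<^sup>+t. ?F v t \<partial>lborel \<partial>lborel) = (\<integral>\<^sup>+t. \<integral>\<^sup>+v. ?F v t \<partial>lborel \<partial>lborel)"
    by (rule lborel_pair.Fubini'[OF Fm, symmetric])
  also have "\<dots> \<le> (\<integral>\<^sup>+t. ennreal (E * Q) * (ennreal (1 / t\<^sup>2) * indicator {T..} t) \<partial>lborel)"
  proof (rule nn_integral_mono)
    fix t :: real
    show "(\<integral>\<^sup>+v. ?F v t \<partial>lborel) \<le> ennreal (E * Q) * (ennreal (1 / t\<^sup>2) * indicator {T..} t)"
    proof (cases "t \<ge> T")
      case True
      have "(\<integral>\<^sup>+v. ?F v t \<partial>lborel) \<le> (\<integral>\<^sup>+v. ennreal (E / t\<^sup>2) *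
          ((1 + (\<integral>\<^sup>+y. ennreal (?q t v y * h y) \<partial>lborel)) * indicator D v) \<partial>lborel)"
        using ET(3)[OF True] D True by (intro nn_integral_mono) (auto split: split_indicator)
      also have "\<dots> = ennreal (E / t\<^sup>2) *
          (\<integral>\<^sup>+v\<in>D. (1 + (\<integral>\<^sup>+y. ennreal (?q t v y * h y) \<partial>lborel)) \<partial>lborel)"
        by (rule nn_integral_cmult) measurable
      also have "\<dots> \<le> ennreal (E / t\<^sup>2) * ennreal Q"
        by (intro mult_left_mono avg) simp
      also have "\<dots> = ennreal (E * Q) * ennreal (1 / t\<^sup>2)"
        using ET Q0 by (simp add: mult_ac flip: ennreal_mult)
      finally show ?thesis using True by simp
    qed simp
  qed
  also have "\<dots> = ennreal (E * Q) * (\<integral>\<^sup>+t\<in>{T..}. ennreal (1 / t\<^sup>2) \<partial>lborel)"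
    by (rule nn_integral_cmult) measurable
  also have "\<dots> < \<infinity>"
    by (simp add: nn_integral_inverse_square[OF ET(2)] ennreal_mult_less_top)
  finally have fin: "(\<integral>\<^sup>+v. \<integral>\<^sup>+t. ?F v t \<partial>lborel \<partial>lborel) < \<infinity>" .
  have "(\<lambda>v. \<integral>\<^sup>+t. ?F v t \<partial>lborel) \<in> borel_measurable lborel"
    by (rule lborel.borel_measurable_nn_integral[OF Fm])
  then have ae: "AE v in lborel. (\<integral>\<^sup>+t. ?F v t \<partial>lborel) \<noteq> \<infinity>"
    by (rule nn_integral_PInf_AE) (use fin in simp)
  have "\<exists>v\<in>D. (\<integral>\<^sup>+t. ?F v t \<partial>lborel) \<noteq> \<infinity>"
  proof (rule ccontr)
    assume "\<not> ?thesis"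
    then have "AE v in lborel. v \<notin> D" using ae by (auto elim!: eventually_mono)
    then have "D \<in> null_sets lborel" by (subst AE_iff_null_sets) auto
    then show False using \<mu> by auto
  qed
  then obtain v where v: "v \<in> D" "(\<integral>\<^sup>+t. ?F v t \<partial>lborel) \<noteq> \<infinity>" by blast
  show ?thesis
  proof (rule that[of v T])
    show "v \<noteq> 0" using D(1)[OF v(1)] by auto
    show "(\<integral>\<^sup>+t\<in>{T..}. ennreal (exp (f (t *\<^sub>R v))) \<partial>lborel) < \<infinity>"
      using v by (simp add: less_top)
  qed
qed

subsection \<open>Completeness\<close>

text \<open>The fundamental theorem of calculus with finitely many exceptional points writes
  \<open>\<gamma> b - \<gamma> a\<close> as the integral of the derivative.\<close>

lemma norm_diff_le_path_length:
  fixes \<gamma> :: "real \<Rightarrow> 'a::euclidean_space"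
  assumes \<gamma>: "\<gamma> piecewise_C1_differentiable_on {a..b}" and ab: "a \<le> b" and c: "c \<ge> 0"
  shows "ennreal (c * norm (\<gamma> b - \<gamma> a)) \<le>
    (\<integral>\<^sup>+t\<in>{a..b}. ennreal (c * norm (vector_derivative \<gamma> (at t))) \<partial>lborel)"
proof -
  obtain S where S: "finite S" "\<gamma> C1_differentiable_on ({a..b} - S)" and cont: "continuous_on {a..b} \<gamma>"
    using \<gamma> by (auto simp: piecewise_C1_differentiable_on_def)
  \<comment> \<open>Setting the derivative to 0 at the break points and outside the interval makes
    it Borel measurable, as it is continuous on the remaining Borel set.\<close>
  define D where "D t = indicator ({a..b} - S) t *\<^sub>R vector_derivative \<gamma> (at t)" for t
  have "{a..b} - S \<in> sets borel"
    using S(1) by (intro sets.Diff) (auto intro: borel_closed finite_imp_closed)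
  then have meas [measurable]: "D \<in> borel_measurable borel"
    unfolding D_def using S(2)
    by (intro borel_measurable_continuous_on_indicator) (auto simp: C1_differentiable_on_eq)
  have "AE t in lborel. t \<notin> S"
    using S(1) by (intro AE_not_in finite_imp_null_set_lborel)
  then have "(\<integral>\<^sup>+t\<in>{a..b}. ennreal (c * norm (vector_derivative \<gamma> (at t))) \<partial>lborel)
      = (\<integral>\<^sup>+t. ennreal c * ennreal (norm (D t)) \<partial>lborel)"
    by (intro nn_integral_cong_AE, eventually_elim)
      (use c in \<open>auto simp: D_def ennreal_mult split: split_indicator\<close>)
  also have "\<dots> = ennreal c * (\<integral>\<^sup>+t. ennreal (norm (D t)) \<partial>lborel)"
    by (rule nn_integral_cmult) measurable
  also have "\<dots> \<ge> ennreal c * ennreal (norm (\<gamma> b - \<gamma> a))"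
  proof (rule mult_left_mono)
    show "ennreal (norm (\<gamma> b - \<gamma> a)) \<le> (\<integral>\<^sup>+t. ennreal (norm (D t)) \<partial>lborel)"
    \<comment> \<open>The derivative may be unbounded near a break point. Either the length is
      infinite and nothing is to be shown, or \<open>D\<close> is Lebesgue integrable and its
      integral agrees with the gauge integral from the fundamental theorem.\<close>
    proof (cases "(\<integral>\<^sup>+t. ennreal (norm (D t)) \<partial>lborel) = \<infinity>")
      case False
      then have int: "integrable lborel D"
        by (intro integrableI_bounded) (auto simp: less_top)
      have "(D has_integral (\<integral>t. D t \<partial>lborel)) UNIV"
        using has_integral_integral_lborel[OF int] .
      moreover have "(\<lambda>t. if t \<in> {a..b} then D t else 0) = D"
        by (auto simp: D_def split: split_indicator)
      ultimately have 1: "(D has_integral (\<integral>t. D t \<partial>lborel)) {a..b}"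
        using has_integral_restrict_UNIV[of "{a..b}" D] by simp
      have "(D has_integral (\<gamma> b - \<gamma> a)) {a..b}"
      proof (rule fundamental_theorem_of_calculus_interior_strong[OF S(1) ab _ cont])
        fix t assume t: "t \<in> {a<..<b} - S"
        then have "\<gamma> differentiable at t" using S(2) by (auto simp: C1_differentiable_on_eq)
        then show "(\<gamma> has_vector_derivative D t) (at t)"
          using t by (simp add: D_def vector_derivative_works)
      qed
      with 1 have "\<gamma> b - \<gamma> a = (\<integral>t. D t \<partial>lborel)" by (rule has_integral_unique[symmetric])
      then have "norm (\<gamma> b - \<gamma> a) \<le> (\<integral>t. norm (D t) \<partial>lborel)" by simp
      then have "ennreal (norm (\<gamma> b - \<gamma> a)) \<le> ennreal (\<integral>t. norm (D t) \<partial>lborel)" by (rule ennreal_leI)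
      also have "\<dots> = (\<integral>\<^sup>+t. ennreal (norm (D t)) \<partial>lborel)"
        using int by (intro nn_integral_eq_integral[symmetric]) auto
      finally show ?thesis .
    qed simp
  qed simp
  finally show ?thesis using c by (simp add: ennreal_mult)
qed

section \<open>Length and distance in a conformal metric\<close>

lemma metric_length_conformal:
  "metric_length (conformal_metric u) \<gamma> =
    (\<integral>\<^sup>+t\<in>{0..1}. ennreal (exp (u (\<gamma> t)) * norm (vector_derivative \<gamma> (at t))) \<partial>lborel)"
proof -
  have "sqrt (exp (2 * u p) * (v \<bullet> v)) = exp (u p) * norm v" for p and v :: "real ^ 'a"
    by (simp add: real_sqrt_mult norm_eq_sqrt_inner exp_double)
  then show ?thesis
    by (simp add: metric_length_def metric_inner_conformal)
qed

text \<open>After the last time \<open>s\<close> at which the path has distance at least 1 from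
  \<open>l\<close>, it stays in the unit ball, where the conformal factor is at least
  \<open>\<delta>\<close>, and still covers Euclidean distance 1.\<close>

lemma metric_length_conformal_ge:
  assumes \<gamma>: "valid_path \<gamma>" "1 \<le> dist (pathstart \<gamma>) l" "pathfinish \<gamma> = l"
    and \<delta>: "\<delta> \<ge> 0" "\<And>x. x \<in> cball l 1 \<Longrightarrow> \<delta> \<le> exp (u x)"
  shows "ennreal \<delta> \<le> metric_length (conformal_metric u) \<gamma>"
proof -
  have C1: "\<gamma> piecewise_C1_differentiable_on {0..1}" using \<gamma> by (simp add: valid_path_def)
  then have cont: "continuous_on {0..1} \<gamma>" by (auto simp: piecewise_C1_differentiable_on_def)
  define T where "T = {t\<in>{0..1}. 1 \<le> dist (\<gamma> t) l}"
  have "T = {0..1} \<inter> (\<lambda>t. dist (\<gamma> t) l) -` {1..}" by (auto simp: T_def)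
  then have "closedin (top_of_set {0..1}) T"
    using cont by (auto intro!: continuous_closedin_preimage continuous_intros)
  then have "compact T" using closedin_compact compact_Icc by blast
  moreover have "0 \<in> T" using \<gamma> by (simp add: T_def pathstart_def)
  ultimately obtain s where s: "s \<in> T" "\<And>t. t \<in> T \<Longrightarrow> t \<le> s"
    using compact_attains_sup[of T] by blast
  have s01: "0 \<le> s" "s \<le> 1" using s by (auto simp: T_def)
  have near: "\<gamma> t \<in> cball l 1" if "s < t" "t \<le> 1" for t
    using that s(2)[of t] s01 by (force simp: T_def dist_commute)
  have "1 \<le> norm (\<gamma> 1 - \<gamma> s)"
    using s \<gamma>(3) by (simp add: T_def pathfinish_def dist_norm norm_minus_commute)
  then have "\<delta> \<le> \<delta> * norm (\<gamma> 1 - \<gamma> s)"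
    using mult_left_mono[of 1 "norm (\<gamma> 1 - \<gamma> s)" \<delta>] \<delta>(1) by simp
  then have "ennreal \<delta> \<le> ennreal (\<delta> * norm (\<gamma> 1 - \<gamma> s))" by (rule ennreal_leI)
  also have "\<dots> \<le> (\<integral>\<^sup>+t\<in>{s..1}. ennreal (\<delta> * norm (vector_derivative \<gamma> (at t))) \<partial>lborel)"
    using s01 \<delta>(1) by (intro norm_diff_le_path_length piecewise_C1_differentiable_on_subset[OF C1]) auto
  also have "\<dots> \<le> metric_length (conformal_metric u) \<gamma>"
    unfolding metric_length_conformal
  proof (rule nn_integral_mono_AE)
    have "AE t in lborel. t \<noteq> s"
      by (rule AE_I[where N = "{s}"]) auto
    then show "AE t in lborel. ennreal (\<delta> * norm (vector_derivative \<gamma> (at t))) * indicator {s..1} t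
      \<le> ennreal (exp (u (\<gamma> t)) * norm (vector_derivative \<gamma> (at t))) * indicator {0..1} t"
    proof eventually_elim
      fix t assume "t \<noteq> s"
      then have "\<delta> * norm (vector_derivative \<gamma> (at t)) \<le> exp (u (\<gamma> t)) * norm (vector_derivative \<gamma> (at t))"
        if "t \<in> {s..1}"
        using that by (intro mult_right_mono \<delta>(2) near) auto
      then show "ennreal (\<delta> * norm (vector_derivative \<gamma> (at t))) * indicator {s..1} t
        \<le> ennreal (exp (u (\<gamma> t)) * norm (vector_derivative \<gamma> (at t))) * indicator {0..1} t"
        using s01 by (auto split: split_indicator intro: ennreal_leI)
    qed
  qed
  finally show ?thesis .
qed

lemma metric_length_linepath:
  "metric_length (conformal_metric u) (linepath x y) =
    (\<integral>\<^sup>+t\<in>{0..1}. ennreal (exp (u (linepath x y t)) * norm (y - x)) \<partial>lborel)"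
  by (simp add: metric_length_conformal)

lemma metric_dist_le:
  assumes "valid_path \<gamma>" "pathstart \<gamma> = x" "pathfinish \<gamma> = y"
    "metric_length G \<gamma> \<le> ennreal c" "c \<ge> 0"
  shows "metric_dist G x y \<le> c"
  unfolding metric_dist_def
  using assms by (intro enn2real_leI) (auto intro!: INF_lower2)

lemma metric_dist_conformal_ge:
  assumes u: "continuous_on UNIV u" and x: "1 \<le> dist x l"
    and \<delta>: "\<delta> \<ge> 0" "\<And>x. x \<in> cball l 1 \<Longrightarrow> \<delta> \<le> exp (u x)"
  shows "\<delta> \<le> metric_dist (conformal_metric u) x l"
proof -
  let ?I = "INF \<gamma>\<in>{\<gamma>. valid_path \<gamma> \<and> pathstart \<gamma> = x \<and> pathfinish \<gamma> = l}. metric_length (conformal_metric u) \<gamma>"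
  \<comment> \<open>\<open>enn2real\<close> would turn an infinite infimum into 0. The straight
    segment, along which the conformal factor is bounded, shows that the infimum is finite.\<close>
  have "compact ((\<lambda>y. exp (u y)) ` closed_segment x l)"
    by (intro compact_continuous_image continuous_intros continuous_on_subset[OF u]) auto
  then obtain M where M: "\<And>y. y \<in> closed_segment x l \<Longrightarrow> exp (u y) \<le> M"
    by (meson bdd_above.unfold bounded_imp_bdd_above compact_imp_bounded imageI)
  have "?I \<le> metric_length (conformal_metric u) (linepath x l)"
    by (intro INF_lower) auto
  also have "\<dots> \<le> (\<integral>\<^sup>+t\<in>{0..1::real}. ennreal (M * norm (l - x)) \<partial>lborel)"
    unfolding metric_length_linepath
    by (intro nn_integral_mono)
      (auto split: split_indicator intro!: ennreal_leI mult_right_mono M linepath_in_path)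
  also have "\<dots> < \<infinity>" by (simp add: nn_integral_cmult_indicator ennreal_mult_less_top)
  finally have fin: "?I < \<infinity>" .
  have "ennreal \<delta> \<le> ?I"
    using x by (intro INF_greatest metric_length_conformal_ge \<delta>) auto
  then have "enn2real (ennreal \<delta>) \<le> enn2real ?I" using fin by (intro enn2real_mono) auto
  then show ?thesis using \<delta> by (simp add: metric_dist_def)
qed

text \<open>Equally spaced points on the ray form a Cauchy sequence, since tails of a convergent
  integral bound their distances. They eventually leave the unit ball around any candidate limit
  \<open>l\<close>, so their distance to \<open>l\<close> stays above the minimum of
  \<open>e^u\<close> on that ball.\<close>

lemma finite_ray_not_complete:
  fixes u :: "real ^ 'n::finite \<Rightarrow> real"
  assumes u: "continuous_on UNIV u" and v: "v \<noteq> 0"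
    and fin: "(\<integral>\<^sup>+t\<in>{T..}. ennreal (exp (u (t *\<^sub>R v))) \<partial>lborel) < \<infinity>"
  shows "\<not> complete_metric (conformal_metric u)"
proof
  assume complete: "complete_metric (conformal_metric u)"
  let ?d = "metric_dist (conformal_metric u)"
  define X where "X k = (T + real k) *\<^sub>R v" for k
  define E where "E t = ennreal (exp (u (t *\<^sub>R v)))" for t
  define J where "J k = (\<integral>\<^sup>+t\<in>{T + real k..}. E t \<partial>lborel)" for k
  have [measurable]: "E \<in> borel_measurable borel"
    unfolding E_def
    by (intro measurable_compose[OF _ measurable_ennreal] borel_measurable_continuous_onI
        continuous_intros continuous_on_compose2[OF u]) auto
  have Jfin: "J k < \<infinity>" for k
  proof -
    have "J k \<le> (\<integral>\<^sup>+t\<in>{T..}. E t \<partial>lborel)"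
      unfolding J_def by (intro nn_integral_mono) (auto split: split_indicator)
    then show ?thesis using fin by (simp add: E_def)
  qed
  have Jmono: "J m \<le> J k" if "k \<le> m" for k m
    unfolding J_def using that by (intro nn_integral_mono) (auto split: split_indicator)
  have "(\<lambda>k. \<integral>\<^sup>+t. E t * indicator {T + real k..} t \<partial>lborel) \<longlonglongrightarrow> (\<integral>\<^sup>+t. 0 \<partial>(lborel :: real measure))"
  proof (rule nn_integral_dominated_convergence[where w = "\<lambda>t. E t * indicator {T..} t"])
    show "AE t in lborel. (\<lambda>k. E t * indicator {T + real k..} t) \<longlonglongrightarrow> 0"
    proof (rule AE_I2, rule tendsto_eventually)
      fix t
      obtain N where "t - T < real N" using reals_Archimedean2 by blast
      then show "\<forall>\<^sub>F k in sequentially. E t * indicator {T + real k..} t = 0"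
        by (intro eventually_sequentiallyI[of N]) (auto split: split_indicator)
    qed
    show "(\<integral>\<^sup>+t\<in>{T..}. E t \<partial>lborel) < \<infinity>" using fin by (simp add: E_def)
  qed (auto split: split_indicator)
  then have J0: "J \<longlonglongrightarrow> 0" by (simp add: J_def[abs_def])
  have dist: "?d (X k) (X m) \<le> enn2real (ennreal (norm v) * J N)" if km: "N \<le> k" "N \<le> m" for k m N
  proof (rule metric_dist_le[where \<gamma> = "linepath (X k) (X m)"])
    define c where "c = real m - real k"
    have "metric_length (conformal_metric u) (linepath (X k) (X m)) \<le> ennreal (norm v) * J N"
    \<comment> \<open>The affine substitution below needs \<open>c\<close> nonzero; for
      \<open>m = k\<close> the path is constant.\<close>
    proof (cases "m = k")
      case False
      then have c: "c \<noteq> 0" by (simp add: c_def)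
      have lp: "linepath (X k) (X m) t = (T + real k + c * t) *\<^sub>R v" for t
        by (simp add: linepath_def X_def c_def algebra_simps)
      have "X m - X k = c *\<^sub>R v" by (simp add: X_def c_def algebra_simps)
      then have "metric_length (conformal_metric u) (linepath (X k) (X m))
        = (\<integral>\<^sup>+t. ennreal (\<bar>c\<bar> * norm v) * (E (T + real k + c * t) * indicator {0..1} t) \<partial>lborel)"
        unfolding metric_length_linepath lp E_def
        by (intro nn_integral_cong) (auto simp: ennreal_mult mult_ac)
      \<comment> \<open>For \<open>t\<close> in \<open>[0, 1]\<close> the position
        \<open>T + k + c t\<close> lies between those of \<open>X k\<close> and \<open>X m\<close>,
        both beyond \<open>T + N\<close>. Enlarging the range to all such \<open>t\<close> lets the
        substitution absorb \<open>|c|\<close>, whichever sign \<open>c\<close> has.\<close>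
      also have "\<dots> \<le> (\<integral>\<^sup>+t. ennreal (\<bar>c\<bar> * norm v) * (E (T + real k + c * t) * indicator {T + real N..} (T + real k + c * t)) \<partial>lborel)"
      proof (intro nn_integral_mono mult_left_mono)
        fix t :: real
        have "real N \<le> real k + c * t" if "0 \<le> t" "t \<le> 1"
        proof -
          have "(1 - t) * real N + t * real N \<le> (1 - t) * real k + t * real m"
            using that km by (intro add_mono mult_left_mono) auto
          then show ?thesis by (simp add: c_def algebra_simps)
        qed
        then show "indicator {0..1} t \<le> (indicator {T + real N..} (T + real k + c * t) :: ennreal)"
          by (auto split: split_indicator)
      qed auto
      also have "\<dots> = ennreal (norm v) * (\<bar>c\<bar> * (\<integral>\<^sup>+t. E (T + real k + c * t) * indicator {T + real N..} (T + real k + c * t) \<partial>lborel))"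
        by (subst nn_integral_cmult) (auto simp: ennreal_mult mult_ac)
      also have "\<dots> = ennreal (norm v) * J N"
        unfolding J_def
        by (subst nn_integral_real_affine[OF _ c, of "\<lambda>t. E t * indicator {T + real N..} t" "T + real k"]) auto
      finally show ?thesis .
    qed (simp add: metric_length_linepath)
    also have "\<dots> = ennreal (enn2real (ennreal (norm v) * J N))"
      using Jfin[of N] by (simp add: ennreal_mult_less_top)
    finally show "metric_length (conformal_metric u) (linepath (X k) (X m))
      \<le> ennreal (enn2real (ennreal (norm v) * J N))" .
  qed auto
  have "\<exists>N. \<forall>k\<ge>N. \<forall>m\<ge>N. ?d (X k) (X m) < e" if e: "e > 0" for e
  proof -
    have "(\<lambda>N. ennreal (norm v) * J N) \<longlonglongrightarrow> ennreal (norm v) * 0"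
      by (intro ennreal_tendsto_cmult J0) auto
    then have "\<forall>\<^sub>F N in sequentially. ennreal (norm v) * J N < ennreal e"
      using e by (intro order_tendstoD(2)) auto
    then obtain N where N: "ennreal (norm v) * J N < ennreal e"
      by (auto simp: eventually_sequentially)
    then have "enn2real (ennreal (norm v) * J N) < e"
      using e by (cases "ennreal (norm v) * J N" rule: ennreal_cases) (auto simp: ennreal_less_iff)
    then show ?thesis using dist by (meson le_less_trans)
  qed
  then obtain l where l: "(\<lambda>k. ?d (X k) l) \<longlonglongrightarrow> 0"
    using complete unfolding complete_metric_def by blast
  have "continuous_on (cball l 1) (\<lambda>x. exp (u x))"
    by (intro continuous_intros continuous_on_subset[OF u]) auto
  then obtain x0 where x0: "\<And>x. x \<in> cball l 1 \<Longrightarrow> exp (u x0) \<le> exp (u x)"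
    using continuous_attains_inf[of "cball l 1" "\<lambda>x. exp (u x)"]
    by (metis centre_in_cball compact_cball empty_iff zero_le_one)
  have "\<forall>\<^sub>F k in sequentially. ?d (X k) l < exp (u x0)"
    using l by (rule order_tendstoD) simp
  moreover have "\<forall>\<^sub>F k in sequentially. 1 \<le> dist (X k) l"
  proof -
    obtain N where N: "(1 + norm l) / norm v - T < real N" using reals_Archimedean2 by blast
    have "\<forall>\<^sub>F k in sequentially. 1 + norm l \<le> (T + real k) * norm v"
    proof (rule eventually_sequentiallyI[of N])
      fix k assume "N \<le> k"
      with N have "(1 + norm l) / norm v \<le> T + real k" by simp
      then show "1 + norm l \<le> (T + real k) * norm v" using v by (simp add: pos_divide_le_eq)
    qed
    then show ?thesis
    proof eventually_elim
      fix k assume "1 + norm l \<le> (T + real k) * norm v"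
      also have "\<dots> \<le> norm (X k)" by (simp add: X_def mult_right_mono)
      also have "\<dots> \<le> dist (X k) l + norm l" by (simp add: dist_norm norm_triangle_sub add.commute)
      finally show "1 \<le> dist (X k) l" by simp
    qed
  qed
  ultimately have "\<forall>\<^sub>F k in sequentially. False"
  proof eventually_elim
    fix k assume "?d (X k) l < exp (u x0)" "1 \<le> dist (X k) l"
    with metric_dist_conformal_ge[OF u, of "X k" l "exp (u x0)"] x0 show False by force
  qed
  then show False by simp
qed

subsection \<open>The sign of the sectional curvature\<close>

lemma Ck_minus: "Ck k f \<Longrightarrow> Ck k (\<lambda>x. - f x)"
proof (induction k arbitrary: f)
  case (Suc k)
  have "partial i (\<lambda>x. - f x) = (\<lambda>x. - partial i f x)" for i
    unfolding partial_def
    by (rule ext, subst frechet_derivative_at[symmetric, OF has_derivative_minus])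
      (use Suc.prems in \<open>auto simp: frechet_derivative_works[symmetric]\<close>)
  with Suc show ?case by auto
qed (auto intro: continuous_on_minus)

lemma partial_minus:
  assumes "smooth f"
  shows "partial i (\<lambda>x. - f x) = (\<lambda>x. - partial i f x)"
  using partial_eqI[OF has_derivative_minus[OF smooth_has_derivative[OF assms]]]
  by (auto simp: grad_def inner_axis)

lemma hess_minus:
  assumes "smooth f"
  shows "hess (\<lambda>x. - f x) p a = - hess f p a"
  by (simp add: hess_def partial_minus assms smooth_partial sum_negf)

lemma hess_grad_const: "hess (\<lambda>x. C) p a = 0" "grad (\<lambda>x. C) p = 0"
proof -
  have "partial i (\<lambda>x. c) = (\<lambda>x. 0)" for i :: 'a and c :: real
    using partial_eqI[OF has_derivative_const] by auto
  then show "hess (\<lambda>x. C) p a = 0" "grad (\<lambda>x. C) p = 0"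
    by (simp_all add: hess_def grad_def vec_eq_iff)
qed

lemma hess_scaleR: "hess f p (s *\<^sub>R a) = s\<^sup>2 * hess f p a"
  by (simp add: hess_def sum_distrib_left power2_eq_square mult_ac)

text \<open>Scaling by \<open>e^u\<close> turns a metric orthonormal pair into a Euclidean one. The
  curvature expression is quadratic in each vector, so \<open>e^(2u)\<close> meets two factors
  \<open>e^(-2u)\<close>; the gradient terms combine by Pythagoras.\<close>

lemma sectional_curvature_conformal_frame:
  assumes u: "smooth u" and E: "metric_orthonormal (conformal_metric u) p E1 E2"
  obtains a b where "norm a = 1" "norm b = 1" "a \<bullet> b = 0"
    "sectional_curvature (conformal_metric u) p E1 E2 = - exp (- 2 * u p) *
      (hess u p a + hess u p b + (norm (grad u p - (grad u p \<bullet> a) *\<^sub>R a - (grad u p \<bullet> b) *\<^sub>R b))\<^sup>2)"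
proof -
  define a b where "a = exp (u p) *\<^sub>R E1" and "b = exp (u p) *\<^sub>R E2"
  let ?g = "grad u p"
  have E: "exp (2 * u p) * (E1 \<bullet> E1) = 1" "exp (2 * u p) * (E2 \<bullet> E2) = 1" "E1 \<bullet> E2 = 0"
    using E by (auto simp: metric_orthonormal_def metric_inner_conformal)
  have ab: "a \<bullet> a = 1" "b \<bullet> b = 1" "a \<bullet> b = 0"
    using E exp_add[of "u p" "u p"] by (auto simp: a_def b_def mult.assoc)
  define r where "r = exp (- u p)"
  have Eab: "E1 = r *\<^sub>R a" "E2 = r *\<^sub>R b" by (simp_all add: r_def a_def b_def flip: exp_add)
  have r: "exp (2 * u p) * r\<^sup>2 = 1" "r\<^sup>2 = exp (- 2 * u p)"
    by (simp_all add: r_def flip: exp_add exp_double)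
  have coef: "exp (2 * u p) * r\<^sup>2 * r\<^sup>2 = exp (- 2 * u p)"
    using r by simp
  have grad: "(norm (?g - (?g \<bullet> a) *\<^sub>R a - (?g \<bullet> b) *\<^sub>R b))\<^sup>2 = ?g \<bullet> ?g - (?g \<bullet> a)\<^sup>2 - (?g \<bullet> b)\<^sup>2"
    unfolding power2_norm_eq_inner using ab
    by (simp add: inner_diff_left inner_diff_right inner_commute power2_eq_square algebra_simps)
  have sec: "sectional_curvature (conformal_metric u) p E1 E2 = exp (2 * u p) * r\<^sup>2 * r\<^sup>2 *
      (- hess u p a - hess u p b + (?g \<bullet> b)\<^sup>2 + (?g \<bullet> a)\<^sup>2 - ?g \<bullet> ?g)"
    unfolding sectional_curvature_conformal[OF u E(3)] unfolding Eab hess_scaleR using ab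
    by (simp add: power_mult_distrib power2_eq_square algebra_simps)
  have "sectional_curvature (conformal_metric u) p E1 E2 = - exp (- 2 * u p) *
      (hess u p a + hess u p b + (norm (?g - (?g \<bullet> a) *\<^sub>R a - (?g \<bullet> b) *\<^sub>R b))\<^sup>2)"
    unfolding sec coef grad by (simp add: algebra_simps)
  with ab show ?thesis by (intro that[of a b]) (auto simp: norm_eq_1)
qed

text \<open>The switch \<open>c\<close> serves both signs of the curvature: with
  \<open>c = 1\<close> completeness provides the mass bound that controls the gradient term, with
  \<open>c = 0\<close> the inequality concerns the Hessian alone.\<close>

lemma normal_potential_hess:
  fixes f :: "real ^ 'n::finite \<Rightarrow> real"
  assumes n: "CARD('n) \<ge> 2" and f: "smooth f" and h: "integrable lborel h" "\<And>y. h y \<ge> 0"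
    and pot: "\<And>x. f x = (\<integral>y. ln (norm y / norm (x - y)) * h y \<partial>lborel) + C"
    and c: "c = 0 \<or> c = 1 \<and> complete_metric (conformal_metric f)"
    and ab: "norm a = 1" "norm b = 1" "a \<bullet> b = 0" and w: "norm w \<le> 1" "w \<bullet> a = 0" "w \<bullet> b = 0"
  shows "hess f p a + hess f p b + c * (grad f p \<bullet> w)\<^sup>2 \<le> 0"
proof (cases rule: normal_potential_cases[OF h pot])
  case 1
  then have "f = (\<lambda>x. C)" by auto
  then show ?thesis by (simp add: hess_grad_const)
next
  case (2 A)
  note cont = smooth_continuous[OF f, of UNIV]
  note ev = log_potential_everywhere[OF n h cont 2]
  \<comment> \<open>Mass above 2 would produce a ray of finite length, which a complete metric
    excludes.\<close>
  have mass: "c * (\<integral>y. h y \<partial>lborel) \<le> 2"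
  proof (rule ccontr)
    assume "\<not> ?thesis"
    with c have m: "(\<integral>y. h y \<partial>lborel) > 2" "complete_metric (conformal_metric f)" by auto
    show False
      using log_potential_finite_ray[OF n h cont ev(1) 2[OF ev(1)] m(1)]
        finite_ray_not_complete[OF cont] m(2) by metis
  qed
  have e: "0 < 1 / real (Suc k)" for k by simp
  show ?thesis
  proof (rule hess_inequality_limit[OF f])
    show "c \<ge> 0" using c by auto
    show "continuous_on UNIV (\<lambda>x. A + reg_potential h (1 / real (Suc k)) x)" for k
      using reg_potential_lipschitz[OF h(1) e[of k]]
      by (auto intro!: continuous_intros dest: lipschitz_on_continuous_on)
    show "((\<lambda>s. A + reg_potential h (1 / real (Suc k)) (x + s *\<^sub>R v)) has_real_derivative
        reg_grad h (1 / real (Suc k)) (x + s *\<^sub>R v) v) (at s)" for k x v s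
      using DERIV_add[OF DERIV_const[of A] reg_potential_line_deriv[OF h(1) e[of k]]] by simp
    show "((\<lambda>s. reg_grad h (1 / real (Suc k)) (x + s *\<^sub>R v) v) has_real_derivative
        reg_hess h (1 / real (Suc k)) (x + s *\<^sub>R v) v) (at s)" for k x v s
      by (rule reg_grad_line_deriv[OF h(1) e])
    show "reg_hess h (1 / real (Suc k)) x a + reg_hess h (1 / real (Suc k)) x b
        + c * (reg_grad h (1 / real (Suc k)) x w)\<^sup>2 \<le> 0" for k x
      using c mass by (intro reg_hess_inequality h e ab w) auto
    show "incseq (\<lambda>k. A + reg_potential h (1 / real (Suc k)) x)" for x
      by (rule ev(2))
    show "(\<lambda>k. A + reg_potential h (1 / real (Suc k)) x) \<longlonglongrightarrow> f x" for x
      by (rule ev(3))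
  qed
qed

theorem theorem1p2:
  fixes u :: "real ^ 'n::finite \<Rightarrow> real"
  assumes "CARD('n) \<ge> 2"
    and "smooth u"
    and "Q_well_defined u"
    and "complete_metric (conformal_metric u)"
    and "normal_metric u"
  shows "((\<forall>x. Q_curvature u x \<ge> 0) \<longrightarrow>
           (\<forall>p E1 E2. metric_orthonormal (conformal_metric u) p E1 E2 \<longrightarrow>
              sectional_curvature (conformal_metric u) p E1 E2 \<ge> 0)) \<and>
         ((\<forall>x. Q_curvature u x \<le> 0) \<longrightarrow>
           (\<forall>p E1 E2. metric_orthonormal (conformal_metric u) p E1 E2 \<longrightarrow>
              sectional_curvature (conformal_metric u) p E1 E2 \<le> 0))"
proof -
  note n = assms(1) and u = assms(2)
  define \<kappa> where "\<kappa> = 2 / (fact (CARD('n) - 1) * sphere_vol CARD('n))"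
  have "unit_ball_vol (real CARD('n) + 1) > 0" by (rule unit_ball_vol_pos) simp
  then have \<kappa>: "\<kappa> > 0"
    unfolding \<kappa>_def sphere_vol_def by (intro divide_pos_pos mult_pos_pos) auto
  define h where "h y = \<kappa> * (Q_curvature u y * exp (real CARD('n) * u y))" for y
  have h: "integrable lborel h"
    using assms(5) unfolding h_def normal_metric_def finite_total_Q_def by auto
  obtain C where "\<And>x. u x = \<kappa> * (LINT y|lborel. ln (norm y / norm (x - y)) * Q_curvature u y
      * exp (real CARD('n) * u y)) + C"
    using assms(5) unfolding normal_metric_def \<kappa>_def by blast
  moreover have "\<kappa> * (LINT y|lborel. ln (norm y / norm (x - y)) * Q_curvature u y
      * exp (real CARD('n) * u y)) = (LINT y|lborel. ln (norm y / norm (x - y)) * h y)" for x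
    unfolding integral_mult_right_zero[symmetric] h_def by (simp only: mult_ac)
  ultimately have pot: "u x = (LINT y|lborel. ln (norm y / norm (x - y)) * h y) + C" for x
    by simp
  show ?thesis
  proof (intro conjI impI allI)
    fix p E1 E2
    assume "\<forall>x. Q_curvature u x \<ge> 0" and E: "metric_orthonormal (conformal_metric u) p E1 E2"
    then have h0: "h y \<ge> 0" for y using \<kappa> by (simp add: h_def)
    obtain a b where ab: "norm a = 1" "norm b = 1" "a \<bullet> b = 0"
      and sec: "sectional_curvature (conformal_metric u) p E1 E2 = - exp (- 2 * u p) *
        (hess u p a + hess u p b + (norm (grad u p - (grad u p \<bullet> a) *\<^sub>R a - (grad u p \<bullet> b) *\<^sub>R b))\<^sup>2)"
      using sectional_curvature_conformal_frame[OF u E] by metis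
    define g' where "g' = grad u p - (grad u p \<bullet> a) *\<^sub>R a - (grad u p \<bullet> b) *\<^sub>R b"
    have aa: "a \<bullet> a = 1" "b \<bullet> b = 1" using ab by (auto simp: norm_eq_1)
    have g': "g' \<bullet> a = 0" "g' \<bullet> b = 0"
      using aa ab inner_commute[of b a] by (auto simp: g'_def inner_diff_left)
    have "grad u p \<bullet> g' = (g' + (grad u p \<bullet> a) *\<^sub>R a + (grad u p \<bullet> b) *\<^sub>R b) \<bullet> g'"
      by (simp add: g'_def)
    also have "\<dots> = (norm g')\<^sup>2"
      using g' inner_commute[of a g'] inner_commute[of b g']
      by (simp add: inner_add_left power2_norm_eq_inner)
    \<comment> \<open>For \<open>g'\<close> nonzero \<open>sgn g'\<close> is the unit vector along
      it, and for \<open>g' = 0\<close> it is 0 and both sides vanish. Taking it as \<open>w\<close>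
      thus recovers the whole norm of \<open>g'\<close>, and its length is at most 1 in both
      cases.\<close>
    finally have gg': "grad u p \<bullet> sgn g' = norm g'"
      by (cases "g' = 0") (auto simp: sgn_div_norm power2_eq_square)
    have "hess u p a + hess u p b + 1 * (grad u p \<bullet> sgn g')\<^sup>2 \<le> 0"
    proof (rule normal_potential_hess[OF n u h h0 pot _ ab])
      show "norm (sgn g') \<le> 1" by (simp add: norm_sgn)
      show "sgn g' \<bullet> a = 0" "sgn g' \<bullet> b = 0" using g' by (simp_all add: sgn_div_norm)
    qed (use assms(4) in simp)
    then show "sectional_curvature (conformal_metric u) p E1 E2 \<ge> 0"
      unfolding sec gg' g'_def[symmetric] by (simp add: mult_nonneg_nonpos)
  next
    fix p E1 E2
    assume "\<forall>x. Q_curvature u x \<le> 0" and E: "metric_orthonormal (conformal_metric u) p E1 E2"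
    then have h0: "- h y \<ge> 0" for y using \<kappa> by (simp add: h_def mult_nonneg_nonpos mult_nonpos_nonneg)
    obtain a b where ab: "norm a = 1" "norm b = 1" "a \<bullet> b = 0"
      and sec: "sectional_curvature (conformal_metric u) p E1 E2 = - exp (- 2 * u p) *
        (hess u p a + hess u p b + (norm (grad u p - (grad u p \<bullet> a) *\<^sub>R a - (grad u p \<bullet> b) *\<^sub>R b))\<^sup>2)"
      using sectional_curvature_conformal_frame[OF u E] by metis
    \<comment> \<open>The negated function is the potential of the non-negative density
      \<open>- h\<close>. Its conformal metric need not be complete, so \<open>c = 0\<close> is
      taken; the squared gradient in the curvature formula already has the favourable sign.\<close>
    have "smooth (\<lambda>x. - u x)" using u by (simp add: smooth_def Ck_minus)
    moreover have "- u x = (LINT y|lborel. ln (norm y / norm (x - y)) * - h y) + - C" for x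
      by (simp add: pot)
    ultimately have "hess (\<lambda>x. - u x) p a + hess (\<lambda>x. - u x) p b + 0 * (grad (\<lambda>x. - u x) p \<bullet> 0)\<^sup>2 \<le> 0"
      using h by (intro normal_potential_hess[OF n _ _ h0 _ _ ab]) auto
    then have "0 \<le> hess u p a + hess u p b" by (simp add: hess_minus[OF u])
    then show "sectional_curvature (conformal_metric u) p E1 E2 \<le> 0"
      unfolding sec by (simp add: mult_nonpos_nonneg)
  qed
qed

end
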